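(* Let $\Sigma$ be a once-punctured torus with the dotted triangulation $\dot\triangle$ described in the context, $T_a,T_b$ the left-hand Dehn twists along the horizontal curve $a$ and the vertical curve $b$, and $\boldsymbol p_a,\boldsymbol p_b$ a $T_a$-invariant, resp. $T_b^{-1}$-invariant coefficient whose component at the flipped edge $1$ is denoted $\mathbf p_1$ in each case. (1) For the Dehn twist $T_a$, $$\langle\underline{\underline{m}},\underline n|\,\mathsf V^{\dot\triangle}_{T_a}(\boldsymbol p_a)\,|\underline{\underline{k}},\underline\ell\rangle=N\,i^{(1-N)/3}\,\Psi_{\mathbf p_1}(q^{2(n-m)})\,\gamma(m-\ell)^{-1}q^{2(n-\ell)k}$$ for $k,\ell,m,n\in\mathbb Z_N$, and $$Z_N(T_a;\boldsymbol p_a)=\Big|\sum_{u\in\mathbb Z_N}\Psi_{\mathbf p_1}(q^{2u})\gamma(u)^{-1}\Big|.$$ (2) For the Dehn twist $T_b^{-1}$, $$\langle\underline{\underline{m}},\underline n|\,\mathsf V^{\dot\triangle}_{T_b^{-1}}(\boldsymbol p_b)\,|\underline{\underline{k}},\underline\ell\rangle=N\,\Psi_{\mathbf p_1}(q^{2(n-m)})\,\gamma(k-m)\,q^{2(n-m-\ell)(m-k)}$$ for $k,\ell,m,n\in\mathbb Z_N$, and $$Z_N(T_b^{-1};\boldsymbol p_b)=\Big|\sum_{u\in\mathbb Z_N}\Psi_{\mathbf p_1}(q^{2u})\Big|.$$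
   Context: $N$ is a positive odd integer, $q=-e^{\pi i/N}$ ($q^N=1$), $\mathbb Z_N=\mathbb Z/N$, $\gamma(k)=q^{k^2}$, $i^x=e^{\pi ix/2}$. Dilogarithm: for $\mathbf p=(p^+,p^-)$ with $(p^+)^N+(p^-)^N=1$, $p^\pm\ne0$, $\Psi_{\mathbf p}(X)=\prod_{j=0}^{N-1}(p^-+q^{2j+1}p^+X)^{j/N}$, defined by a convergent power series on $|yX|<1$ ($y=p^+/p^-$) and continued analytically to $\mathbb C\setminus\bigcup_k\{|yX|>1,\arg(yX)=\pi(2k+1)/N\}$, with branches obtained by continuation from $\mathbf p=(0,1)$, so that $\Psi_{\mathbf p}(q^{2k})=\Psi_{\mathbf p}(1)\prod_{j=1}^k(p^-+q^{2j-1}p^+)$; generic $\mathbf p$. For $\mathsf X^N=1$, $\Psi_{\mathbf p}(\mathsf X)$ acts on $q^{2k}$-eigenvectors by $\Psi_{\mathbf p}(q^{2k})$. Weyl ordering: $[X_1\cdots X_n]=q^{-\sum_{i<j}\epsilon_{ij}}X_1\cdots X_n$ if $X_iX_j=q^{2\epsilon_{ij}}X_jX_i$. $V_N$ has basis $|k\rangle$, $k\in\mathbb Z_N$, dual basis $\langle k|$, $\mathsf U|k\rangle=q^{2k}|k\rangle$, $\mathsf P|k\rangle=|k+1\rangle$. Put $|\underline\ell\rangle=\sum_kq^{-2k\ell}|k\rangle$, $\langle\underline\ell|=\sum_kq^{2k\ell}\langle k|$, $|\underline{\underline k}\rangle=\sum_m\gamma(m)^{-1}q^{-2km}|m\rangle$,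 $\langle\underline{\underline\ell}|=\sum_m\gamma(m)q^{2m\ell}\langle m|$. These satisfy $\mathsf P|\underline\ell\rangle=q^{2\ell}|\underline\ell\rangle$, $[\mathsf P\mathsf U^{-1}]|\underline{\underline k}\rangle=q^{2k}|\underline{\underline k}\rangle$, $\langle\underline m|\underline\ell\rangle=N\delta_{m\ell}=\langle\underline{\underline m}|\underline{\underline\ell}\rangle$. Triangulation: the unit square with opposite sides identified, diagonal from $(0,1)$ to $(1,0)$ (edge $1$), vertical side edge $2$, horizontal side edge $3$; $v$ is the lower-left triangle with dot at $(0,0)$, $w$ the upper-right triangle with dot at $(1,0)$. $V_{\dot\triangle}=V_N\otimes V_N$, the first factor for $v$, the second for $w$. Operators: $\mathsf A_w$ acts on the $w$-factor by $|k\rangle\mapsto N^{-1/2}i^{(1-N)/6}|\underline{\underline k}\rangle$; $\mathsf T_{vw}=\Psi_{\mathbf p_1}([\mathsf P_v^{-1}\mathsf U_v\mathsf P_w])\frac1N\sum_{i,j=0}^{N-1}q^{2ij}\mathsf U_w^i\mathsf P_v^j$; $\mathsf P_{(vw)}$ exchanges the two factors. The flip sequence for $T_a$ (resp. $T_b^{-1}$) is the flip at edge $1$ followed by a relabelling, and the local intertwiners are $$\mathsf V^{\dot\triangle}_{T_a}(\boldsymbol p_a)=\mathsf T_{vw}\mathsf A_w^{-1}\mathsf P_{(vw)},\qquad \mathsf V^{\dot\triangle}_{T_b^{-1}}(\boldsymbol p_b)=\mathsf T_{vw}.$$ $Z_N(\phi;\boldsymbol p)=|\mathrm{Tr}\,\mathsf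 V^{\dot\triangle}_\phi(\boldsymbol p)|$. *)

theory Defs
  imports "HOL-Analysis.Analysis" "Berlekamp_Zassenhaus.Finite_Field"
begin

section \<open>Roots of unity\<close>

definition q :: "nat \<Rightarrow> complex" where
  "q N = - exp (complex_of_real pi * \<i> / of_nat N)"

text \<open>\<open>\<int>/N\<close> is the type \<open>'n mod_ring\<close> with \<open>N = CARD('n)\<close>. The numerals and the unit of
  \<open>mod_ring\<close> need \<open>N > 1\<close>, hence \<open>of_int_mod_ring 1\<close> below. For odd \<open>N\<close> we have \<open>q ^ N = 1\<close>, so that
  \<open>q2 k = q^(2k)\<close> and \<open>gam k = q^(k^2)\<close> depend on the class of \<open>k\<close> only.\<close>

definition q2 :: "'n::finite mod_ring \<Rightarrow> complex" where
  "q2 k = q CARD('n) powi (2 * to_int_mod_ring k)"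

definition gam :: "'n::finite mod_ring \<Rightarrow> complex" where
  "gam k = q CARD('n) powi ((to_int_mod_ring k)\<^sup>2)"

definition ipow :: "real \<Rightarrow> complex" where
  "ipow x = exp (complex_of_real pi * \<i> * of_real x / 2)"

section \<open>Coefficients and the cyclic quantum dilogarithm\<close>

text \<open>A pair \<open>(p\<^sup>+, p\<^sup>-)\<close> is stored as \<open>(fst p, snd p)\<close>.\<close>

definition fermat_curve :: "nat \<Rightarrow> (complex \<times> complex) set" where
  "fermat_curve N = {p. fst p ^ N + snd p ^ N = 1}"

datatype edge = Edge1 | Edge2 | Edge3

definition coefficient :: "nat \<Rightarrow> (edge \<Rightarrow> complex \<times> complex) \<Rightarrow> bool" where
  "coefficient N p \<longleftrightarrow> (\<forall>e. p e \<in> fermat_curve N \<and> fst (p e) \<noteq> 0 \<and> snd (p e) \<noteq> 0)"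

text \<open>\<open>dilog_continuation N g X z\<close>: the number \<open>z\<close> is the value of
  \<open>\<Prod>j<N. (p\<^sup>- + q^(2j+1) p\<^sup>+ X)^(j/N)\<close> at the end of the path \<open>g\<close>, each factor being continued
  along \<open>g\<close> from \<open>1\<close> at \<open>p = (0,1)\<close>; here \<open>L j\<close> is the continued logarithm of the \<open>j\<close>-th factor.\<close>

definition dilog_continuation ::
  "nat \<Rightarrow> (real \<Rightarrow> complex \<times> complex) \<Rightarrow> complex \<Rightarrow> complex \<Rightarrow> bool" where
  "dilog_continuation N g X z \<longleftrightarrow>
     (\<exists>L :: nat \<Rightarrow> real \<Rightarrow> complex.
        (\<forall>j<N. continuous_on {0..1} (L j) \<and> L j 0 = 0 \<and>
           (\<forall>t\<in>{0..1}. exp (L j t) = snd (g t) + q N ^ (2 * j + 1) * fst (g t) * X)) \<and>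
        z = (\<Prod>j<N. exp (of_nat j / of_nat N * L j 1)))"

text \<open>A branch of \<open>\<Psi>\<^sub>p\<close>, as a function on the \<open>N\<close>-th roots of unity, by continuation from
  \<open>p = (0,1)\<close>. If \<open>X^N = 1\<close> then \<open>\<Prod>j<N. (p\<^sup>- + q^(2j+1) p\<^sup>+ X) = (p\<^sup>-)^N + (p\<^sup>+)^N = 1\<close>, so no factor
  vanishes on the curve and the continuation is never obstructed. All the values \<open>\<Psi>\<^sub>p (q^(2k))\<close>
  are taken along one path; this is what yields \<open>dilog_branch_prod\<close>. When \<open>p\<^sup>-\<close> is the value of
  \<open>(1 + y^N)^(-1/N)\<close>, \<open>y = p\<^sup>+/p\<^sup>-\<close>, that is continued radially from \<open>1\<close> at \<open>y = 0\<close>, this recovers the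
  power series in \<open>X\<close> and its continuation to the cut plane: see \<open>dilog_branch_cut_plane\<close>.\<close>

definition dilog_branch :: "nat \<Rightarrow> complex \<times> complex \<Rightarrow> (complex \<Rightarrow> complex) \<Rightarrow> bool" where
  "dilog_branch N p \<Psi> \<longleftrightarrow>
     (\<exists>g. path g \<and> pathstart g = (0, 1) \<and> pathfinish g = p \<and> path_image g \<subseteq> fermat_curve N \<and>
        (\<forall>X. X ^ N = 1 \<longrightarrow> dilog_continuation N g X (\<Psi> X)))"

lemma q_pow_N:
  assumes "odd N" shows "q N ^ N = 1"
proof -
  have N: "N > 0" using assms by (cases N) auto
  have "exp (complex_of_real pi * \<i> / of_nat N) ^ N = exp (complex_of_real pi * \<i>)"
    using N by (subst exp_of_nat_mult [symmetric]) simp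
  then show ?thesis using assms by (simp add: q_def power_minus_odd)
qed

lemma q_square: "q N ^ 2 = cis (2 * pi / real N)"
proof -
  have "q N ^ 2 = exp (complex_of_real pi * \<i> / of_nat N) ^ 2" by (simp add: q_def)
  also have "\<dots> = exp (2 * (complex_of_real pi * \<i> / of_nat N))"
    by (metis exp_double)
  also have "2 * (complex_of_real pi * \<i> / of_nat N) = \<i> * complex_of_real (2 * pi / real N)"
    by simp
  finally show ?thesis by (simp add: cis_conv_exp)
qed

lemma prod_roots_of_unity:
  assumes "odd N"
  shows "(\<Prod>j<N. a + q N ^ (2 * j + 1) * b) = a ^ N + b ^ N"
proof -
  have N: "N > 0" using assms by (cases N) auto
  have q0: "q N \<noteq> 0" by (simp add: q_def)
  define w where "w = q N ^ 2"
  have wN: "(w ^ j) ^ N = 1" for j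
    using q_pow_N [OF assms] by (metis w_def power_mult mult.commute power_one)
  have inj: "inj_on (\<lambda>j. w ^ j) {..<N}"
  proof (rule inj_onI)
    fix i j assume ij: "i \<in> {..<N}" "j \<in> {..<N}" "w ^ i = w ^ j"
    have "w ^ k = cis (2 * pi * real k / real N)" for k
      by (simp add: w_def q_square Complex.DeMoivre) (simp add: mult_ac)
    moreover have "bij_betw (\<lambda>k. cis (2 * pi * real k / real N)) {..<N} {z. z ^ N = 1}"
      using Complex.bij_betw_roots_unity [OF N] by simp
    ultimately show "i = j" using ij unfolding bij_betw_def inj_on_def by auto
  qed
  have fact: "x ^ N - c ^ N = (\<Prod>j<N. x - w ^ j * c)" for x c :: complex
  proof (cases "c = 0")
    case True then show ?thesis using N by (simp add: power_0_left)
  next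
    case False
    define P1 where "P1 = Polynomial.monom 1 N - [:c ^ N:]"
    define P2 where "P2 = (\<Prod>j<N. [:- (w ^ j * c), 1:])"
    have d2: "degree P2 = N" "lead_coeff P2 = 1"
      unfolding P2_def by (subst degree_prod_eq_sum_degree) (auto simp: lead_coeff_prod)
    have "P1 = P2"
    proof (rule poly_eqI_degree_lead_coeff)
      show "poly.coeff P1 N = poly.coeff P2 N" using d2 N by (simp add: P1_def coeff_pCons split: nat.split)
      show "degree P1 \<le> N" unfolding P1_def by (intro degree_diff_le) (auto simp: degree_monom_le)
      show "degree P2 \<le> N" using d2 by simp
      show "N \<le> card ((\<lambda>j. w ^ j * c) ` {..<N})"
        using inj False by (subst card_image) (auto simp: inj_on_def)
      fix x assume "x \<in> (\<lambda>j. w ^ j * c) ` {..<N}"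
      then obtain j where j: "j < N" "x = w ^ j * c" by auto
      have "poly P1 x = 0" using wN j by (simp add: P1_def poly_monom power_mult_distrib)
      moreover have "poly P2 x = 0" unfolding P2_def poly_prod using j by (auto intro!: prod_zero)
      ultimately show "poly P1 x = poly P2 x" by simp
    qed
    then have "poly P1 x = poly P2 x" by simp
    then show ?thesis by (simp add: P1_def P2_def poly_monom poly_prod)
  qed
  have "(\<Prod>j<N. a + q N ^ (2 * j + 1) * b) = (\<Prod>j<N. a - w ^ j * (- q N * b))"
    unfolding w_def power_add power_mult by (intro prod.cong) (auto simp: algebra_simps)
  also have "\<dots> = a ^ N - (- q N * b) ^ N" by (rule fact [symmetric])
  also have "\<dots> = a ^ N + b ^ N" using assms q_pow_N [OF assms] by (simp add: power_mult_distrib power_minus_odd)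
  finally show ?thesis .
qed

lemma continuous_log_unique:
  fixes h :: "real \<Rightarrow> complex"
  assumes "continuous_on {0..1} h" "h 0 = 0" "\<And>t. t \<in> {0..1} \<Longrightarrow> exp (h t) = 1" "t \<in> {0..1}"
  shows "h t = 0"
proof -
  have "h constant_on {0..1}"
  proof (rule continuous_discrete_range_constant)
    show "connected {0..1::real}" by simp
    show "continuous_on {0..1} h" by fact
    show "\<exists>e>0. \<forall>y. y \<in> {0..1} \<and> h y \<noteq> h x \<longrightarrow> e \<le> norm (h y - h x)" if "x \<in> {0..1}" for x
    proof (intro exI [of _ "2 * pi"] conjI allI impI)
      fix y assume y: "y \<in> {0..1} \<and> h y \<noteq> h x"
      obtain n where n: "h y - h x = of_real (of_int (2 * n) * pi) * \<i>"
      proof -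
        have "exp (h y - h x) = 1" using assms(3)[of y] assms(3)[of x] y \<open>x \<in> {0..1}\<close> by (simp add: exp_diff)
        then obtain n where "Re (h y - h x) = 0" "Im (h y - h x) = of_int (2 * n) * pi"
          using exp_eq_1 by blast
        then show ?thesis by (intro that [of n]) (simp add: complex_eq_iff)
      qed
      have "n \<noteq> 0" using n y by auto
      then have "1 \<le> \<bar>real_of_int n\<bar>" by linarith
      then have "2 * pi * 1 \<le> 2 * pi * \<bar>real_of_int n\<bar>" by (intro mult_left_mono) auto
      then show "2 * pi \<le> norm (h y - h x)" by (simp add: n norm_mult abs_mult mult_ac)
    qed simp
  qed
  then show ?thesis using assms(2,4) unfolding constant_on_def by auto
qed

lemma dilog_branch_step:
  assumes N: "odd N" and br: "dilog_branch N p \<Psi>" and X: "X ^ N = 1"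
  shows "\<Psi> (q N ^ 2 * X) = \<Psi> X * (snd p + q N * fst p * X)"
proof -
  obtain n where n: "N = Suc n" using N by (cases N) auto
  obtain g where g: "pathfinish g = p" "path_image g \<subseteq> fermat_curve N"
    and cont: "\<And>X. X ^ N = 1 \<Longrightarrow> dilog_continuation N g X (\<Psi> X)"
    using br unfolding dilog_branch_def by auto
  have g1: "g 1 = p" using g by (simp add: pathfinish_def)
  have curve: "fst (g t) ^ N + snd (g t) ^ N = 1" if "t \<in> {0..1}" for t
    using g(2) imageI [OF that, of g] unfolding path_image_def fermat_curve_def by blast
  have X': "(q N ^ 2 * X) ^ N = 1"
    using X q_pow_N [OF N] by (metis mult_1 power_commutes power_mult power_mult_distrib power_one mult.commute)
  obtain L where L: "\<And>j. j < N \<Longrightarrow> continuous_on {0..1} (L j)" "\<And>j. j < N \<Longrightarrow> L j 0 = 0"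
      "\<And>j t. j < N \<Longrightarrow> t \<in> {0..1} \<Longrightarrow> exp (L j t) = snd (g t) + q N ^ (2 * j + 1) * fst (g t) * X"
    and LX: "\<Psi> X = (\<Prod>j<N. exp (of_nat j / of_nat N * L j 1))"
    using cont [OF X] unfolding dilog_continuation_def by blast
  obtain M where M: "\<And>j. j < N \<Longrightarrow> continuous_on {0..1} (M j)" "\<And>j. j < N \<Longrightarrow> M j 0 = 0"
      "\<And>j t. j < N \<Longrightarrow> t \<in> {0..1} \<Longrightarrow>
         exp (M j t) = snd (g t) + q N ^ (2 * j + 1) * fst (g t) * (q N ^ 2 * X)"
    and MX: "\<Psi> (q N ^ 2 * X) = (\<Prod>j<N. exp (of_nat j / of_nat N * M j 1))"
    using cont [OF X'] unfolding dilog_continuation_def by blast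
  define s where "s j = (if j = n then 0 else Suc j)" for j
  have s: "s j < N" if "j < N" for j using that n by (auto simp: s_def)
  have ex: "exp (M j t) = exp (L (s j) t)" if "j < N" "t \<in> {0..1}" for j t
  proof (cases "j = n")
    case True
    have "q N ^ (2 * n + 1) * q N ^ 2 = q N ^ N * q N ^ N * q N"
      by (simp add: n mult_2 mult_2_right power_add power2_eq_square mult_ac)
    then have "q N ^ (2 * n + 1) * q N ^ 2 = q N" using q_pow_N [OF N] by simp
    then have "q N ^ (2 * j + 1) * fst (g t) * (q N ^ 2 * X) = q N * fst (g t) * X"
      using True by (metis mult.assoc mult.commute)
    then show ?thesis using M(3)[OF that] L(3)[OF s[OF that(1)] that(2)] True
      by (simp add: s_def)
  next
    case False
    then show ?thesis using M(3)[OF that] L(3)[OF s[OF that(1)] that(2)] 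
      by (simp add: s_def power_add power2_eq_square mult_ac)
  qed
  have M_eq: "M j 1 = L (s j) 1" if "j < N" for j
  proof -
    have "M j 1 - L (s j) 1 = 0"
    proof (rule continuous_log_unique [of "\<lambda>t. M j t - L (s j) t"])
      show "continuous_on {0..1} (\<lambda>t. M j t - L (s j) t)"
        using M(1)[OF that] L(1)[OF s[OF that]] by (rule continuous_on_diff)
      show "M j 0 - L (s j) 0 = 0" using M(2)[OF that] L(2)[OF s[OF that]] by simp
      show "exp (M j t - L (s j) t) = 1" if "t \<in> {0..1}" for t
        unfolding exp_diff ex [OF \<open>j < N\<close> that] by simp
    qed simp
    then show ?thesis by simp
  qed
  have sumL: "(\<Sum>j<N. L j 1) = 0"
  proof (rule continuous_log_unique [of "\<lambda>t. \<Sum>j<N. L j t"])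
    show "continuous_on {0..1} (\<lambda>t. \<Sum>j<N. L j t)" using L by (auto intro!: continuous_on_sum)
    show "(\<Sum>j<N. L j 0) = 0" using L by simp
    fix t :: real assume t: "t \<in> {0..1}"
    have "exp (\<Sum>j<N. L j t) = (\<Prod>j<N. snd (g t) + q N ^ (2 * j + 1) * (fst (g t) * X))"
      using L t by (simp add: exp_sum mult_ac)
    also have "\<dots> = snd (g t) ^ N + (fst (g t) * X) ^ N" by (rule prod_roots_of_unity [OF N])
    also have "\<dots> = 1" using curve [OF t] X by (simp add: power_mult_distrib add.commute)
    finally show "exp (\<Sum>j<N. L j t) = 1" .
  qed simp
  have N0: "of_nat N \<noteq> (0::complex)" using n by (simp del: of_nat_Suc)
  have alg: "a - (- b) / c + d / c * b = a + (d + 1) / c * b" for a b c d :: complex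
    by (simp add: add_divide_distrib distrib_right)
  have "(\<Sum>j<N. of_nat j / of_nat N * M j 1) =
        (\<Sum>j<n. of_nat j / of_nat N * L (Suc j) 1) + of_nat n / of_nat N * L 0 1"
    by (simp add: M_eq n s_def)
  also have "(\<Sum>j<n. of_nat j / of_nat N * L (Suc j) 1) =
        (\<Sum>j<n. of_nat (Suc j) / of_nat N * L (Suc j) 1) - (\<Sum>j<n. L (Suc j) 1) / of_nat N"
    unfolding sum_divide_distrib by (simp flip: sum_subtractf) (simp add: field_simps diff_divide_distrib add_divide_distrib)
  also have "(\<Sum>j<n. of_nat (Suc j) / of_nat N * L (Suc j) 1) = (\<Sum>j<N. of_nat j / of_nat N * L j 1)"
    unfolding n sum.lessThan_Suc_shift by simp
  also have "(\<Sum>j<n. L (Suc j) 1) = - L 0 1"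
    using sumL unfolding n sum.lessThan_Suc_shift by (simp add: add_eq_0_iff)
  also have "(\<Sum>j<N. of_nat j / of_nat N * L j 1) - (- L 0 1) / of_nat N + of_nat n / of_nat N * L 0 1 =
      (\<Sum>j<N. of_nat j / of_nat N * L j 1) + (of_nat n + 1) / of_nat N * L 0 1"
    by (rule alg)
  also have "(of_nat n + 1) / of_nat N = (1::complex)" using N0 by (simp add: n)
  finally have "\<Psi> (q N ^ 2 * X) = \<Psi> X * exp (L 0 1)"
    unfolding LX MX by (simp add: exp_add flip: exp_sum)
  also have "exp (L 0 1) = snd p + q N * fst p * X" using L(3)[of 0 1] n g1 by simp
  finally show ?thesis .
qed

lemma dilog_branch_prod:
  assumes "odd N" "dilog_branch N p \<Psi>"
  shows "\<Psi> (q N ^ (2 * k)) = \<Psi> 1 * (\<Prod>j=1..k. snd p + q N ^ (2 * j - 1) * fst p)"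
proof (induction k)
  case (Suc k)
  have "(q N ^ (2 * k)) ^ N = 1"
    using q_pow_N [OF assms(1)] by (metis mult.commute power_mult power_one)
  from dilog_branch_step [OF assms this]
  have "\<Psi> (q N ^ (2 * Suc k)) = \<Psi> (q N ^ (2 * k)) * (snd p + q N ^ (2 * Suc k - 1) * fst p)"
    by (simp add: power2_eq_square mult_ac)
  then show ?case using Suc by (simp add: mult.assoc)
qed simp

lemma dilog_branch_cut_plane:
  assumes N: "odd N" and p: "p \<in> fermat_curve N" "snd p \<noteq> 0"
    and y: "y = fst p / snd p" "1 + y ^ N \<notin> \<real>\<^sub>\<le>\<^sub>0" "snd p = (1 + y ^ N) powr (- 1 / of_nat N)"
  shows "dilog_branch N p (\<lambda>X. snd p ^ ((N - 1) div 2) *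
           (\<Prod>j<N. (1 + q N ^ (2 * j + 1) * y * X) powr (of_nat j / of_nat N)))"
proof -
  have N0: "N > 0" using N by (cases N) auto
  have star: "1 + of_real r * y ^ N \<notin> \<real>\<^sub>\<le>\<^sub>0" if "r \<in> {0..1}" for r :: real
  proof
    assume *: "1 + of_real r * y ^ N \<in> \<real>\<^sub>\<le>\<^sub>0"
    then have "Im (y ^ N) = 0 \<or> r = 0" "1 + r * Re (y ^ N) \<le> 0"
      by (auto simp: complex_nonpos_Reals_iff)
    moreover from this(2) have "r \<noteq> 0" "Re (y ^ N) \<le> -1"
    proof -
      show "r \<noteq> 0" using \<open>1 + r * Re (y ^ N) \<le> 0\<close> by auto
      show "Re (y ^ N) \<le> -1"
      proof (rule ccontr)
        assume "\<not> Re (y ^ N) \<le> -1"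
        then have "r * Re (y ^ N) > r * -1" using \<open>r \<noteq> 0\<close> that by (intro mult_strict_left_mono) auto
        then show False using \<open>1 + r * Re (y ^ N) \<le> 0\<close> that by auto
      qed
    qed
    ultimately show False using y(2) by (auto simp: complex_nonpos_Reals_iff)
  qed
  have tN: "t ^ N \<in> {0..1}" if "t \<in> {0..1}" for t :: real
    using that by (auto simp: power_le_one)
  define D where "D t = 1 + (of_real t * y) ^ N" for t :: real
  have D: "D t \<notin> \<real>\<^sub>\<le>\<^sub>0" if "t \<in> {0..1}" for t
    using star [OF tN [OF that]] by (simp add: D_def power_mult_distrib)
  have D0: "D t \<noteq> 0" if "t \<in> {0..1}" for t using D [OF that] by auto
  define u where "u t = exp (- Ln (D t) / of_nat N)" for t
  have Dc: "continuous_on {0..1} (\<lambda>t. Ln (D t))"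
    by (intro continuous_on_Ln') (use D in \<open>auto simp: D_def intro!: continuous_intros\<close>)
  then have uc: "continuous_on {0..1} u"
    unfolding u_def using N0 by (intro continuous_on_exp continuous_on_divide continuous_on_minus) auto
  have uN: "u t ^ N = inverse (D t)" if "t \<in> {0..1}" for t
    using D0 [OF that] N0 unfolding u_def
    by (subst exp_of_nat_mult [symmetric]) (simp add: exp_minus)
  have u1: "u 1 = snd p" using y(3) D0 [of 1] by (auto simp: u_def D_def powr_def)
  define g where "g t = (of_real t * y * u t, u t)" for t :: real
  have fac: "1 + q N ^ (2 * j + 1) * (of_real t * y) * X \<notin> \<real>\<^sub>\<le>\<^sub>0"
    if X: "X ^ N = 1" and t: "t \<in> {0..1}" and j: "j < N" for X t j
  proof
    assume *: "1 + q N ^ (2 * j + 1) * (of_real t * y) * X \<in> \<real>\<^sub>\<le>\<^sub>0"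
    define z where "z = q N ^ (2 * j + 1) * (of_real t * y) * X"
    obtain r where r: "1 + z = of_real r" "r \<le> 0"
      using * unfolding z_def [symmetric] by (elim nonpos_Reals_cases)
    define x where "x = r - 1"
    have x: "z = of_real x" "x \<le> -1"
      using r by (auto simp: x_def algebra_simps)
    have "z ^ N = (of_real t * y) ^ N"
      using X q_pow_N [OF N]
      by (simp add: z_def power_mult_distrib flip: power_mult) (metis mult.commute power_mult power_one mult_1)
    then have "D t = of_real (1 + x ^ N)" by (simp add: D_def x)
    moreover have "x ^ N \<le> -1"
    proof -
      have "1 \<le> (- x) ^ N" using x by (intro one_le_power) auto
      then show ?thesis using N by (simp add: power_minus_odd)
    qed
    ultimately show False using D [OF t] by (simp add: complex_nonpos_Reals_iff)
  qed
  have "dilog_continuation N g X (snd p ^ ((N - 1) div 2) *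
           (\<Prod>j<N. (1 + q N ^ (2 * j + 1) * y * X) powr (of_nat j / of_nat N)))" if X: "X ^ N = 1" for X
  proof -
    define L where "L j t = Ln (1 + q N ^ (2 * j + 1) * (of_real t * y) * X) - Ln (D t) / of_nat N"
      for j :: nat and t :: real
    have "continuous_on {0..1} (L j) \<and> L j 0 = 0 \<and>
           (\<forall>t\<in>{0..1}. exp (L j t) = snd (g t) + q N ^ (2 * j + 1) * fst (g t) * X)" if j: "j < N" for j
    proof (intro conjI ballI)
      show "continuous_on {0..1} (L j)" unfolding L_def using N0
        by (intro continuous_on_diff continuous_on_divide continuous_on_Ln' Dc) 
          (use fac X j in \<open>auto intro!: continuous_intros\<close>)
      show "L j 0 = 0" using N0 by (simp add: L_def D_def power_0_left)
      fix t :: real assume t: "t \<in> {0..1}"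
      have "1 + q N ^ (2 * j + 1) * (of_real t * y) * X \<noteq> 0" using fac [OF X t j] by auto
      then have "exp (L j t) = (1 + q N ^ (2 * j + 1) * (of_real t * y) * X) * u t"
        unfolding L_def u_def diff_conv_add_uminus exp_add by simp
      then show "exp (L j t) = snd (g t) + q N ^ (2 * j + 1) * fst (g t) * X"
        by (simp add: g_def algebra_simps)
    qed
    moreover have "snd p ^ ((N - 1) div 2) *
           (\<Prod>j<N. (1 + q N ^ (2 * j + 1) * y * X) powr (of_nat j / of_nat N)) =
        (\<Prod>j<N. exp (of_nat j / of_nat N * L j 1))"
    proof -
      have e: "exp (of_nat j / of_nat N * L j 1) =
          (1 + q N ^ (2 * j + 1) * y * X) powr (of_nat j / of_nat N) *
          exp (of_nat j * (- Ln (D 1) / of_nat N / of_nat N))" if "j < N" for j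
      proof -
        have nz: "1 + q N ^ (2 * j + 1) * y * X \<noteq> 0" using fac [OF X _ that, of 1] by auto
        have "of_nat j / of_nat N * L j 1 =
            of_nat j / of_nat N * Ln (1 + q N ^ (2 * j + 1) * y * X) +
            of_nat j * (- Ln (D 1) / of_nat N / of_nat N)"
          by (simp add: L_def right_diff_distrib)
        then show ?thesis using nz by (simp only: exp_add powr_def if_False)
      qed
      obtain m where m: "N = 2 * m + 1" using N by (elim oddE)
      have "(\<Sum>j<2 * m + 1. j) = m * (2 * m + 1)"
        by (induction m) (auto simp: algebra_simps)
      then have "(\<Sum>j<N. j) = m * N" by (simp only: m)
      then have sj: "(\<Sum>j<N. of_nat j :: complex) = of_nat m * of_nat N"
        by (simp only: flip: of_nat_sum of_nat_mult)
      have "(\<Prod>j<N. exp (of_nat j * (- Ln (D 1) / of_nat N / of_nat N))) =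
          exp ((\<Sum>j<N. of_nat j) * (- Ln (D 1) / of_nat N / of_nat N))"
        unfolding sum_distrib_right by (rule exp_sum [symmetric]) simp
      also have "\<dots> = exp (of_nat m * (- Ln (D 1) / of_nat N))" using N0 by (simp add: sj)
      also have "\<dots> = snd p ^ m" unfolding exp_of_nat_mult u1 [symmetric] u_def ..
      finally have "(\<Prod>j<N. exp (of_nat j * (- Ln (D 1) / of_nat N / of_nat N))) = snd p ^ ((N - 1) div 2)"
        by (simp add: m)
      then show ?thesis using e by (simp add: prod.distrib)
    qed
    ultimately show ?thesis unfolding dilog_continuation_def by blast
  qed
  moreover have "path g" unfolding path_def g_def using uc by (intro continuous_intros)
  moreover have "pathstart g = (0, 1)" using N0 by (simp add: pathstart_def g_def u_def D_def power_0_left)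
  moreover have "pathfinish g = p" using p(2) y(1) u1 by (simp add: pathfinish_def g_def prod_eq_iff)
  moreover have "path_image g \<subseteq> fermat_curve N"
  proof
    fix x assume "x \<in> path_image g"
    then obtain t where t: "t \<in> {0..1}" "x = g t" by (auto simp: path_image_def)
    have "fst x ^ N + snd x ^ N = D t * u t ^ N" by (simp add: t g_def D_def power_mult_distrib algebra_simps)
    then show "x \<in> fermat_curve N" using uN [OF t(1)] D0 [OF t(1)] by (simp add: fermat_curve_def)
  qed
  ultimately show ?thesis unfolding dilog_branch_def by blast
qed

section \<open>The local representation\<close>

abbreviation scale_mat :: "complex \<Rightarrow> complex^'i^'j \<Rightarrow> complex^'i^'j" (infixr "*\<^sub>m" 75) where
  "c *\<^sub>m M \<equiv> map_matrix ((*) c) M"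

definition mat_pow :: "complex^'i^'i \<Rightarrow> nat \<Rightarrow> complex^'i^'i" where
  "mat_pow M k = ((\<lambda>A. M ** A) ^^ k) (mat 1)"

definition is_weyl_exponent :: "nat \<Rightarrow> (complex^'i^'i) list \<Rightarrow> (nat \<Rightarrow> nat \<Rightarrow> int) \<Rightarrow> bool" where
  "is_weyl_exponent N Xs \<epsilon> \<longleftrightarrow>
     (\<forall>i<length Xs. \<forall>j<length Xs.
        Xs ! i ** Xs ! j = (q N powi (2 * \<epsilon> i j)) *\<^sub>m (Xs ! j ** Xs ! i))"

text \<open>The exponents are unique modulo \<open>N\<close> when \<open>N\<close> is odd and the \<open>X\<^sub>i\<close> are invertible.\<close>

definition weyl :: "nat \<Rightarrow> (complex^'i^'i) list \<Rightarrow> complex^'i^'i" where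
  "weyl N Xs = (let \<epsilon> = (SOME \<epsilon>. is_weyl_exponent N Xs \<epsilon>) in
     (q N powi (- (\<Sum>j<length Xs. \<Sum>i<j. \<epsilon> i j))) *\<^sub>m foldr (**) Xs (mat 1))"

text \<open>\<open>f(X)\<close> for \<open>X^N = 1\<close>: it acts on the \<open>q^(2k)\<close>-eigenvectors of \<open>X\<close>, which span, by \<open>f (q^(2k))\<close>.\<close>

definition root_fun :: "nat \<Rightarrow> (complex \<Rightarrow> complex) \<Rightarrow> complex^'i^'i \<Rightarrow> complex^'i^'i" where
  "root_fun N f X = (THE M. \<forall>k::int. \<forall>x.
     X *v x = (q N powi (2 * k)) *s x \<longrightarrow> M *v x = f (q N powi (2 * k)) *s x)"

type_synonym 'n state = "complex^('n mod_ring)"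
type_synonym 'n operator = "complex^('n mod_ring)^('n mod_ring)"
type_synonym 'n state2 = "complex^('n mod_ring \<times> 'n mod_ring)"
type_synonym 'n operator2 =
  "complex^('n mod_ring \<times> 'n mod_ring)^('n mod_ring \<times> 'n mod_ring)"

text \<open>Matrices act on coordinate columns with respect to the basis \<open>|k\<rangle>\<close>. A bra is the vector of
  its coordinates in the dual basis, and is paired bilinearly.\<close>

definition ket :: "'n::finite mod_ring \<Rightarrow> 'n state" where
  "ket k = axis k 1"

definition bra :: "'n::finite mod_ring \<Rightarrow> 'n state" where
  "bra k = axis k 1"

definition U_op :: "'n::finite operator" where
  "U_op = (\<chi> i k. (q2 k *s ket k) $ i)"

definition P_op :: "'n::finite operator" where
  "P_op = (\<chi> i k. ket (k + of_int_mod_ring 1) $ i)"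

definition ket_P :: "'n::finite mod_ring \<Rightarrow> 'n state" where
  "ket_P l = (\<Sum>k\<in>UNIV. inverse (q2 (k * l)) *s ket k)"

definition bra_P :: "'n::finite mod_ring \<Rightarrow> 'n state" where
  "bra_P l = (\<Sum>k\<in>UNIV. q2 (k * l) *s bra k)"

definition ket_PU :: "'n::finite mod_ring \<Rightarrow> 'n state" where
  "ket_PU k = (\<Sum>m\<in>UNIV. (inverse (gam m) * inverse (q2 (k * m))) *s ket m)"

definition bra_PU :: "'n::finite mod_ring \<Rightarrow> 'n state" where
  "bra_PU l = (\<Sum>m\<in>UNIV. (gam m * q2 (m * l)) *s bra m)"

definition A_op :: "'n::finite operator" where
  "A_op = (\<chi> i k. (((1 / of_real (sqrt (real CARD('n)))) * ipow ((1 - real CARD('n)) / 6)) *s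
                 ket_PU k) $ i)"

section \<open>The once-punctured torus with two dotted triangles\<close>

text \<open>\<open>V\<^sub>N \<otimes> V\<^sub>N\<close> has coordinates indexed by pairs; the first factor belongs to \<open>v\<close>, the second
  to \<open>w\<close>.\<close>

definition tensor :: "'n::finite state \<Rightarrow> 'n state \<Rightarrow> 'n state2" (infixr "\<otimes>\<^sub>v" 72) where
  "x \<otimes>\<^sub>v y = (\<chi> i. x $ fst i * y $ snd i)"

definition tensor_op :: "'n::finite operator \<Rightarrow> 'n operator \<Rightarrow> 'n operator2" where
  "tensor_op M M' = (\<chi> i k. M $ fst i $ fst k * M' $ snd i $ snd k)"

definition at_v :: "'n::finite operator \<Rightarrow> 'n operator2" where
  "at_v M = tensor_op M (mat 1)"

definition at_w :: "'n::finite operator \<Rightarrow> 'n operator2" where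
  "at_w M = tensor_op (mat 1) M"

definition swap_vw :: "'n::finite operator2" where
  "swap_vw = (\<chi> i k. (ket (snd k) \<otimes>\<^sub>v ket (fst k)) $ i)"

definition T_vw :: "(complex \<Rightarrow> complex) \<Rightarrow> 'n::finite operator2" where
  "T_vw \<Psi> = root_fun CARD('n) \<Psi> (weyl CARD('n) [matrix_inv (at_v P_op), at_v U_op, at_w P_op]) **
     ((1 / of_nat CARD('n)) *\<^sub>m
        (\<Sum>i<CARD('n). \<Sum>j<CARD('n).
           (q CARD('n) ^ (2 * i * j)) *\<^sub>m (mat_pow (at_w U_op) i ** mat_pow (at_v P_op) j)))"

text \<open>In the next definitions \<open>\<Psi> x\<close> is the chosen branch of the dilogarithm at \<open>x\<close>. Both
  sequences flip \<open>Edge1\<close> only.\<close>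

definition V_Ta :: "(complex \<times> complex \<Rightarrow> complex \<Rightarrow> complex) \<Rightarrow>
    (edge \<Rightarrow> complex \<times> complex) \<Rightarrow> 'n::finite operator2" where
  "V_Ta \<Psi> p = T_vw (\<Psi> (p Edge1)) ** matrix_inv (at_w A_op) ** swap_vw"

definition V_Tb_inv :: "(complex \<times> complex \<Rightarrow> complex \<Rightarrow> complex) \<Rightarrow>
    (edge \<Rightarrow> complex \<times> complex) \<Rightarrow> 'n::finite operator2" where
  "V_Tb_inv \<Psi> p = T_vw (\<Psi> (p Edge1))"

definition Z_inv :: "'n::finite operator2 \<Rightarrow> real" where
  "Z_inv M = cmod (trace M)"

definition matrix_element :: "'n::finite state2 \<Rightarrow> 'n operator2 \<Rightarrow> 'n state2 \<Rightarrow> complex" where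
  "matrix_element b M x = (\<Sum>i\<in>UNIV. b $ i * (M *v x) $ i)"

end

theory Submission
  imports Defs
begin

text \<open>The vectors \<open>ket_PU k \<otimes>\<^sub>v ket_P l\<close> diagonalise the argument of the dilogarithm in \<open>T_vw\<close> with
  eigenvalue \<open>q^(2(l-k))\<close>, so the dilogarithm contributes only the factor \<open>\<Psi> (q^(2(n-m)))\<close>; the
  remaining factor of \<open>T_vw\<close> is the permutation \<open>|a, b\<rangle> \<mapsto> |a - b, b\<rangle>\<close>. What is left are character sums
  over \<open>\<int>/N\<close> and, for \<open>T_a\<close>, the quadratic Gauss sum \<open>\<Sum>u. q^(u^2) = \<surd>N i^((1-N)/2)\<close>, including its
  phase. The phase is obtained by Gauss's method: completing the square turns the Gauss sum into an
  alternating sum of \<open>x\<close>-binomial coefficients at \<open>x = q^(-2)\<close>, which factors into sines of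
  known sign.\<close>

section \<open>Powers of the root of unity\<close>

lemma q_nonzero [simp]: "q N \<noteq> 0"
  by (simp add: q_def)

lemma q_powi_mod:
  assumes "odd N"
  shows "q N powi (a mod int N) = q N powi a"
proof -
  have "q N powi a = q N powi (int N * (a div int N) + a mod int N)"
    by simp
  also have "\<dots> = (q N powi int N) powi (a div int N) * q N powi (a mod int N)"
    by (subst power_int_add) (simp_all add: power_int_mult)
  finally show ?thesis
    using q_pow_N [OF assms] by simp
qed

lemma q_powi_cong:
  assumes "odd N" "[a = b] (mod int N)"
  shows "q N powi a = q N powi b"
  using assms by (metis q_powi_mod cong_def)

lemma norm_q [simp]: "cmod (q N) = 1"
  by (simp add: q_def norm_exp)

section \<open>The quadratic Gauss sum\<close>

text \<open>The Gaussian binomial coefficient, defined by Pascal's rule because the usual quotient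
  of factors \<open>1 - x ^ j\<close> may divide by zero at a root of unity.\<close>

fun qbinom :: "'a::comm_ring_1 \<Rightarrow> nat \<Rightarrow> nat \<Rightarrow> 'a" where
  "qbinom x n 0 = 1"
| "qbinom x 0 (Suc k) = 0"
| "qbinom x (Suc n) (Suc k) = qbinom x n k + x ^ Suc k * qbinom x n (Suc k)"

lemma qbinom_eq_0: "n < k \<Longrightarrow> qbinom x n k = 0"
  by (induction x n k rule: qbinom.induct) auto

text \<open>A division-free substitute for the quotient formula. For positive \<open>k\<close> the
  inductive step combines the hypotheses at \<open>k\<close> and \<open>k - 1\<close> through
  Pascal's rule.\<close>

lemma qbinom_absorption:
  "(1 - x ^ Suc k) * qbinom x (Suc n) (Suc k) = (1 - x ^ Suc n) * qbinom x n k"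
proof (induction n arbitrary: k)
  case 0
  then show ?case by (cases k) auto
next
  case (Suc n)
  show ?case
  proof (cases k)
    case 0
    have "(1 - x) * qbinom x (Suc (Suc n)) (Suc 0) = 1 - x + x * ((1 - x) * qbinom x (Suc n) (Suc 0))"
      by (simp add: algebra_simps)
    also have "(1 - x) * qbinom x (Suc n) (Suc 0) = 1 - x ^ Suc n"
      using Suc.IH [of 0] by simp
    finally show ?thesis
      using 0 by (simp add: algebra_simps)
  next
    case (Suc l)
    define A B C where "A = qbinom x n l" and "B = qbinom x n (Suc l)" and "C = qbinom x (Suc n) (Suc k)"
    have 1: "(1 - x ^ Suc k) * C = (1 - x ^ Suc n) * B"
      using Suc.IH [of k] Suc by (simp add: B_def C_def)
    have 2: "(1 - x ^ k) * (A + x ^ k * B) = (1 - x ^ Suc n) * A"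
      using Suc.IH [of l] Suc by (simp add: A_def B_def)
    have 3: "qbinom x (Suc n) k = A + x ^ k * B" "qbinom x (Suc (Suc n)) (Suc k) = A + x ^ k * B + x ^ Suc k * C"
      using Suc by (simp_all add: A_def B_def C_def)
    have "(1 - x ^ Suc k) * (A + x ^ k * B + x ^ Suc k * C) =
        (1 - x ^ Suc k) * (A + x ^ k * B) + x ^ Suc k * ((1 - x ^ Suc k) * C)"
      by (simp add: algebra_simps)
    also have "\<dots> = (1 - x ^ Suc k) * (A + x ^ k * B) + x ^ Suc k * (1 - x ^ Suc n) * B"
      unfolding 1 by (simp add: algebra_simps)
    \<comment> \<open>The subtracted bracket is the difference of the two sides of fact
      \<open>2\<close>, hence zero.\<close>
    also have "\<dots> = (1 - x ^ Suc (Suc n)) * (A + x ^ k * B) -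
        x * ((1 - x ^ Suc n) * A - (1 - x ^ k) * (A + x ^ k * B))"
      by (simp add: algebra_simps)
    also have "\<dots> = (1 - x ^ Suc (Suc n)) * (A + x ^ k * B)"
      unfolding 2 by simp
    finally show ?thesis unfolding 3 .
  qed
qed

text \<open>Pascal's rule rewrites the sum one level down with weights \<open>x ^ k - 1\<close>;
  absorption trades each weight for the common factor and descends one more level.\<close>

lemma alternating_sum_qbinom_step:
  "(\<Sum>k\<le>Suc (Suc n). (-1) ^ k * qbinom x (Suc (Suc n)) k) =
   (1 - x ^ Suc n) * (\<Sum>k\<le>n. (-1) ^ k * qbinom x n k)"
proof -
  define c where "c k = (-1) ^ k * qbinom x (Suc n) k" for k
  have "(\<Sum>k\<le>Suc (Suc n). (-1) ^ k * qbinom x (Suc (Suc n)) k) =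
      1 + (\<Sum>k\<le>Suc n. x ^ Suc k * c (Suc k) - c k)"
    unfolding sum.atMost_Suc_shift [of _ "Suc n"]
    by (auto simp: c_def algebra_simps intro!: sum.cong)
  \<comment> \<open>The isolated 1 becomes the term of index 0. The new top term is zero by
    \<open>qbinom_eq_0\<close> and is dropped next.\<close>
  also have "\<dots> = (\<Sum>k\<le>Suc (Suc n). x ^ k * c k) - (\<Sum>k\<le>Suc n. c k)"
    unfolding sum.atMost_Suc_shift [of _ "Suc n"] by (simp add: sum_subtractf c_def)
  also have "\<dots> = (\<Sum>k\<le>Suc n. (x ^ k - 1) * c k)"
    by (simp add: c_def qbinom_eq_0 sum_subtractf algebra_simps)
  also have "\<dots> = (\<Sum>k\<le>n. (-1) ^ k * ((1 - x ^ Suc k) * qbinom x (Suc n) (Suc k)))"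
    unfolding sum.atMost_Suc_shift by (simp add: c_def algebra_simps)
  also have "\<dots> = (1 - x ^ Suc n) * (\<Sum>k\<le>n. (-1) ^ k * qbinom x n k)"
    unfolding qbinom_absorption sum_distrib_left by (simp only: mult_ac)
  finally show ?thesis .
qed

text \<open>The recursion descends by two and ends at upper index 0 with sum 1; hence the even upper
  index and one odd exponent per step.\<close>

theorem gauss_alternating_sum_qbinom:
  "(\<Sum>k\<le>2 * m. (-1) ^ k * qbinom x (2 * m) k) = (\<Prod>j<m. 1 - x ^ (2 * j + 1))"
proof (induction m)
  case (Suc m)
  then show ?case
    using alternating_sum_qbinom_step [of x "2 * m"] by (simp add: mult.commute)
qed simp

text \<open>As \<open>x\<close> has order \<open>n + 1\<close>, absorption at level
  \<open>n + 1\<close> has right side zero, so the ratio of consecutive coefficients is minus a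
  power of \<open>1 / x\<close>. The triangular exponent collects these powers.\<close>

lemma qbinom_root_of_unity:
  fixes x :: "'a::field"
  assumes "x ^ Suc n = 1" "\<And>j. 0 < j \<Longrightarrow> j \<le> n \<Longrightarrow> x ^ j \<noteq> 1" "k \<le> n"
  shows "(-1) ^ k * qbinom x n k * x ^ (\<Sum>j\<le>k. j) = 1"
  using assms(3)
proof (induction k)
  case (Suc k)
  define A B where "A = qbinom x n k" and "B = qbinom x n (Suc k)"
  have x: "1 - x ^ Suc k \<noteq> 0"
    using assms(2) [of "Suc k"] Suc.prems by (simp del: power_Suc)
  have "(1 - x ^ Suc k) * (A + x ^ Suc k * B) = 0"
    using qbinom_absorption [of x k n] assms(1) by (simp add: A_def B_def del: power_Suc)
  with x have "x ^ Suc k * B = - A"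
    by (simp add: add_eq_0_iff del: power_Suc)
  moreover have "(-1) ^ Suc k * B * x ^ (\<Sum>j\<le>Suc k. j) =
      - ((-1) ^ k * (x ^ Suc k * B) * x ^ (\<Sum>j\<le>k. j))"
    by (simp add: power_add mult_ac)
  ultimately have "(-1) ^ Suc k * B * x ^ (\<Sum>j\<le>Suc k. j) = (-1) ^ k * A * x ^ (\<Sum>j\<le>k. j)"
    by (simp del: power_Suc)
  then show ?case
    using Suc by (simp add: A_def B_def)
qed simp

text \<open>Primitivity of \<open>q N ^ 2\<close>, which feeds both the evaluation of
  \<open>qbinom\<close> and the orthogonality of characters.\<close>

lemma q_square_power_neq_1:
  assumes "0 < j" "j < N"
  shows "(q N ^ 2) ^ j \<noteq> 1"
proof -
  have "(q N ^ 2) ^ j = exp (2 * of_real pi * \<i> * of_nat j / of_nat N)"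
    unfolding q_square Complex.DeMoivre by (simp add: cis_conv_exp mult_ac)
  then show ?thesis
    using assms complex_root_unity_eq_1 [of N j] by (auto dest: dvd_imp_le)
qed

section \<open>Characters and Gaussians on Z/N\<close>

locale odd_order =
  fixes n_type :: "'n::finite itself"
  assumes odd_card: "odd CARD('n)"
begin

lemmas qN = q_pow_N [OF odd_card]
lemmas q_cong = q_powi_cong [OF odd_card]

text \<open>Since \<open>q ^ N = 1\<close>, any integer representative may replace the one chosen by
  \<open>to_int_mod_ring\<close>; functional equations then become identities of integer
  exponents.\<close>

lemma q2_of_int: "q2 (of_int_mod_ring a :: 'n mod_ring) = q CARD('n) powi (2 * a)"
  and gam_of_int: "gam (of_int_mod_ring a :: 'n mod_ring) = q CARD('n) powi (a\<^sup>2)"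
proof -
  have "to_int_mod_ring (of_int_mod_ring a :: 'n mod_ring) = a mod int CARD('n)"
    by transfer simp
  then show "q2 (of_int_mod_ring a :: 'n mod_ring) = q CARD('n) powi (2 * a)"
    "gam (of_int_mod_ring a :: 'n mod_ring) = q CARD('n) powi (a\<^sup>2)"
    unfolding q2_def gam_def by (auto intro!: q_cong simp: cong_def mod_simps)
qed

lemma of_int_mod_ring_add:
  "of_int_mod_ring (a + b) = (of_int_mod_ring a + of_int_mod_ring b :: 'n mod_ring)"
  by transfer (simp add: mod_simps)

lemma of_int_mod_ring_mult:
  "of_int_mod_ring (a * b) = (of_int_mod_ring a * of_int_mod_ring b :: 'n mod_ring)"
  by transfer (simp add: mod_simps)

lemma of_int_mod_ring_cases: obtains i where "(a :: 'n mod_ring) = of_int_mod_ring i"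
  by (metis of_int_mod_ring_to_int_mod_ring)

lemma q2_add: "q2 (a + b :: 'n mod_ring) = q2 a * q2 b"
  by (cases a rule: of_int_mod_ring_cases, cases b rule: of_int_mod_ring_cases)
    (simp add: q2_of_int distrib_left power_int_add flip: of_int_mod_ring_add)

text \<open>The cross term in the square of a sum makes \<open>gam\<close> a quadratic refinement of
  the pairing \<open>q2 (a * b)\<close>. The norm of the Gauss sum and the later matrix elements
  rest on this.\<close>

lemma gam_add: "gam (a + b :: 'n mod_ring) = gam a * gam b * q2 (a * b)"
  by (cases a rule: of_int_mod_ring_cases, cases b rule: of_int_mod_ring_cases)
    (simp add: q2_of_int gam_of_int power2_sum power_int_add mult_ac
      flip: of_int_mod_ring_add of_int_mod_ring_mult)

lemma q2_0 [simp]: "q2 (0 :: 'n mod_ring) = 1"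
  and gam_0 [simp]: "gam (0 :: 'n mod_ring) = 1"
  by (simp_all add: q2_def gam_def)

lemma norm_q2 [simp]: "cmod (q2 (a :: 'n mod_ring)) = 1"
  and norm_gam [simp]: "cmod (gam (a :: 'n mod_ring)) = 1"
  by (simp_all add: q2_def gam_def norm_power_int)

lemma q2_nonzero [simp]: "q2 (a :: 'n mod_ring) \<noteq> 0"
  and gam_nonzero [simp]: "gam (a :: 'n mod_ring) \<noteq> 0"
  by (simp_all add: q2_def gam_def)

lemma q2_minus: "q2 (- a :: 'n mod_ring) = inverse (q2 a)"
  using q2_add [of a "- a"] by (simp add: field_simps)

lemma q2_diff: "q2 (a - b :: 'n mod_ring) = q2 a * inverse (q2 b)"
  using q2_add [of a "- b"] by (simp add: q2_minus)

lemma gam_minus: "gam (- a :: 'n mod_ring) = gam a"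
proof (cases a rule: of_int_mod_ring_cases)
  case (1 i)
  have "a + of_int_mod_ring (- i) = 0"
    unfolding 1 of_int_mod_ring_add [symmetric] by simp
  then have "- a = of_int_mod_ring (- i)"
    by (simp add: minus_unique)
  then show ?thesis
    unfolding 1 by (simp add: gam_of_int del: of_int_mod_ring_to_int_mod_ring)
qed

lemma sum_mod_ring: "(\<Sum>a\<in>(UNIV :: 'n mod_ring set). f a) = (\<Sum>i<CARD('n). f (of_int_mod_ring (int i)))"
proof (rule sum.reindex_bij_witness [of _ "\<lambda>i. of_int_mod_ring (int i)" "\<lambda>a. nat (to_int_mod_ring a)"])
  fix a :: "'n mod_ring"
  have "to_int_mod_ring a \<in> {0..<int CARD('n)}"
    using range_to_int_mod_ring by blast
  then show "of_int_mod_ring (int (nat (to_int_mod_ring a))) = a"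
    "nat (to_int_mod_ring a) \<in> {..<CARD('n)}" by auto
  then show "f (of_int_mod_ring (int (nat (to_int_mod_ring a)))) = f a" by simp
qed auto

lemma sum_shift: "(\<Sum>a\<in>UNIV. f (a + c)) = (\<Sum>a\<in>(UNIV :: 'n mod_ring set). f a)"
  by (rule sum.reindex_bij_witness [of _ "\<lambda>a. a - c" "\<lambda>a. a + c"]) auto

lemma q2_eq_1_iff: "q2 (a :: 'n mod_ring) = 1 \<longleftrightarrow> a = 0"
proof
  assume q2: "q2 a = 1"
  have r: "to_int_mod_ring a \<in> {0..<int CARD('n)}"
    using range_to_int_mod_ring by blast
  then have "q2 a = (q CARD('n) ^ 2) ^ nat (to_int_mod_ring a)"
    unfolding q2_def by (simp add: power_int_def nat_mult_distrib power_mult)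
  then have "\<not> 0 < nat (to_int_mod_ring a)"
    using q2 r q_square_power_neq_1 [of "nat (to_int_mod_ring a)" "CARD('n)"]
    by (auto simp: nat_less_iff)
  then have "to_int_mod_ring a = 0" using r by auto
  then show "a = 0" by simp
qed simp

lemma of_int_mod_ring_1_mult: "of_int_mod_ring 1 * a = (a :: 'n mod_ring)"
  by (cases a rule: of_int_mod_ring_cases) (simp flip: of_int_mod_ring_mult)

text \<open>Translating the summation variable by the class of 1 multiplies the sum by
  \<open>q2 b\<close>, which differs from 1 unless \<open>b = 0\<close>.\<close>

lemma sum_q2: "(\<Sum>a\<in>UNIV. q2 (a * b :: 'n mod_ring)) = (if b = 0 then of_nat CARD('n) else 0)"
proof (cases "b = 0")
  case False
  have "(\<Sum>a\<in>UNIV. q2 (a * b)) = (\<Sum>a\<in>UNIV. q2 ((a + of_int_mod_ring 1) * b))"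
    by (rule sum_shift [symmetric])
  also have "\<dots> = q2 b * (\<Sum>a\<in>UNIV. q2 (a * b))"
    unfolding distrib_right of_int_mod_ring_1_mult q2_add sum_distrib_left
    by (simp only: mult.commute)
  finally show ?thesis
    using False q2_eq_1_iff [of b] by simp
qed simp

section \<open>Modulus and phase of the Gauss sum\<close>

definition gauss_sum :: complex where
  "gauss_sum = (\<Sum>u\<in>(UNIV :: 'n mod_ring set). gam u)"

text \<open>In the squared modulus, translating \<open>u\<close> by \<open>v\<close> cancels
  \<open>gam v\<close> and leaves a character sum over \<open>v\<close>, which only
  \<open>u = 0\<close> survives.\<close>

lemma norm_gauss_sum: "cmod gauss_sum = sqrt (real CARD('n))"
proof -
  have cnj: "cnj (gam v) = inverse (gam v)" for v :: "'n mod_ring"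
    using complex_norm_square [of "gam v"] by (simp add: inverse_unique)
  have "complex_of_real ((cmod gauss_sum)\<^sup>2) = gauss_sum * cnj gauss_sum"
    by (rule complex_norm_square)
  also have "\<dots> = (\<Sum>v\<in>(UNIV :: 'n mod_ring set).
      (\<Sum>u\<in>(UNIV :: 'n mod_ring set). gam u) * inverse (gam v))"
    by (simp add: gauss_sum_def cnj sum_distrib_left)
  also have "\<dots> = (\<Sum>v\<in>(UNIV :: 'n mod_ring set).
      (\<Sum>u\<in>(UNIV :: 'n mod_ring set). gam (u + v)) * inverse (gam v))"
    by (simp only: sum_shift)
  also have "\<dots> = (\<Sum>v\<in>UNIV. \<Sum>u\<in>UNIV. gam u * q2 (v * u :: 'n mod_ring))"
    unfolding sum_distrib_right by (intro sum.cong) (simp_all add: gam_add mult.commute)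
  also have "\<dots> = (\<Sum>u\<in>UNIV. gam u * (\<Sum>v\<in>UNIV. q2 (v * u :: 'n mod_ring)))"
    by (subst sum.swap) (simp add: sum_distrib_left)
  also have "\<dots> = of_nat CARD('n)"
    by (simp add: sum_q2 if_distrib [of "\<lambda>x. _ * x"] cong: if_cong)
  finally have "complex_of_real ((cmod gauss_sum)\<^sup>2) = complex_of_real (real CARD('n))"
    by simp
  then have "(cmod gauss_sum)\<^sup>2 = real CARD('n)"
    by (simp only: of_real_eq_iff)
  then show ?thesis
    using real_sqrt_unique [of "cmod gauss_sum"] by simp
qed

text \<open>Each factor \<open>1 - x ^ (2 * j + 1)\<close> is \<open>- \<i>\<close> times a real
  sine times a power of \<open>Q\<close>. The powers of \<open>Q\<close> cancel in total, so the
  phase is isolated in \<open>(- \<i>) ^ m\<close>, up to the sign of the sines.\<close>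

lemma gauss_sum_eq_prod:
  assumes m: "CARD('n) = 2 * m + 1"
  shows "gauss_sum = (- \<i>) ^ m * of_real (\<Prod>j<m. 2 * sin (pi * real (2 * j + 1) / real CARD('n)))"
proof -
  define Q where "Q = q CARD('n)"
  \<comment> \<open>With this choice the triangular exponent in \<open>qbinom_root_of_unity\<close>
    becomes \<open>k * (k + 1)\<close>, the exponent left after completing the square.\<close>
  define x where "x = inverse (Q ^ 2)"
  have Q0 [simp]: "Q \<noteq> 0" by (simp add: Q_def)
  have QN: "Q ^ CARD('n) = 1" by (simp add: Q_def qN)
  have "x ^ CARD('n) = inverse ((Q ^ CARD('n)) ^ 2)"
    by (simp only: x_def power_inverse mult.commute flip: power_mult)
  then have x1: "x ^ Suc (2 * m) = 1"
    using QN m by (simp del: power_Suc)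
  \<comment> \<open>\<open>m + 1\<close> is the inverse of \<open>2\<close> modulo \<open>N\<close>, so \<open>(k + (m + 1))^2 \<equiv> k (k + 1) + (m + 1)^2\<close>\<close>
  have "gauss_sum = (\<Sum>u\<in>(UNIV :: 'n mod_ring set). gam (u + of_int_mod_ring (int m + 1)))"
    unfolding gauss_sum_def by (simp only: sum_shift)
  also have "\<dots> = (\<Sum>k<CARD('n). Q ^ ((m + 1)\<^sup>2) * Q ^ (k * (k + 1)))"
    unfolding sum_mod_ring
  proof (rule sum.cong)
    fix k
    have "gam (of_int_mod_ring (int k) + of_int_mod_ring (int m + 1) :: 'n mod_ring) =
        Q powi ((int k + (int m + 1))\<^sup>2)"
      by (simp add: Q_def gam_of_int flip: of_int_mod_ring_add)
    also have "(int k + (int m + 1))\<^sup>2 = int (CARD('n) * k + ((m + 1)\<^sup>2 + k * (k + 1)))"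
      by (simp add: m power2_eq_square algebra_simps)
    also have "Q powi \<dots> = Q ^ ((m + 1)\<^sup>2) * Q ^ (k * (k + 1))"
      unfolding power_int_of_nat power_add power_mult QN by simp
    finally show "gam (of_int_mod_ring (int k) + of_int_mod_ring (int m + 1) :: 'n mod_ring) =
        Q ^ ((m + 1)\<^sup>2) * Q ^ (k * (k + 1))" .
  qed simp
  also have "\<dots> = Q ^ ((m + 1)\<^sup>2) * (\<Sum>k<CARD('n). Q ^ (k * (k + 1)))"
    by (simp add: sum_distrib_left)
  also have "(\<Sum>k<CARD('n). Q ^ (k * (k + 1))) = (\<Sum>k\<le>2 * m. (-1) ^ k * qbinom x (2 * m) k)"
  proof (rule sum.cong)
    show "{..<CARD('n)} = {..2 * m}" using m by auto
    fix k assume "k \<in> {..2 * m}"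
    moreover have "x ^ j \<noteq> 1" if "0 < j" "j \<le> 2 * m" for j
      using q_square_power_neq_1 [of j "CARD('n)"] that m
      by (simp add: x_def Q_def power_inverse)
    ultimately have "(-1) ^ k * qbinom x (2 * m) k * x ^ (\<Sum>j\<le>k. j) = 1"
      using qbinom_root_of_unity [OF x1] by simp
    moreover have "2 * (\<Sum>j\<le>k. j) = k * (k + 1)"
      by (induction k) auto
    then have "x ^ (\<Sum>j\<le>k. j) = inverse (Q ^ (k * (k + 1)))"
      unfolding x_def by (simp add: power_inverse flip: power_mult)
    ultimately show "Q ^ (k * (k + 1)) = (-1) ^ k * qbinom x (2 * m) k"
      by (simp add: field_simps)
  qed
  also have "\<dots> = (\<Prod>j<m. 1 - x ^ (2 * j + 1))"
    by (rule gauss_alternating_sum_qbinom)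
  also have "\<dots> = (\<Prod>j<m. (- \<i>) * of_real (2 * sin (pi * real (2 * j + 1) / real CARD('n))) *
      inverse (Q ^ (2 * j + 1)))"
  proof (rule prod.cong)
    fix j
    define \<theta> where "\<theta> = pi * real (2 * j + 1) / real CARD('n)"
    \<comment> \<open>The odd exponent preserves the minus sign, which is why the difference below
      is \<open>- \<i>\<close> rather than \<open>\<i>\<close> times a sine.\<close>
    have "Q = - cis (pi / real CARD('n))"
      by (simp add: Q_def q_def cis_conv_exp mult_ac)
    then have Qj: "Q ^ (2 * j + 1) = - cis \<theta>"
      by (simp add: power_minus_odd Complex.DeMoivre \<theta>_def mult_ac del: power_Suc)
    have "1 - inverse (z\<^sup>2) = (z - inverse z) * inverse z" if "z \<noteq> 0" for z :: complex
      using that by (simp add: field_simps power2_eq_square)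
    moreover have "x ^ (2 * j + 1) = inverse ((Q ^ (2 * j + 1))\<^sup>2)"
      by (simp only: x_def power_inverse mult.commute flip: power_mult)
    ultimately have "1 - x ^ (2 * j + 1) =
        (Q ^ (2 * j + 1) - inverse (Q ^ (2 * j + 1))) * inverse (Q ^ (2 * j + 1))"
      by simp
    also have "Q ^ (2 * j + 1) - inverse (Q ^ (2 * j + 1)) = (- \<i>) * of_real (2 * sin \<theta>)"
      unfolding Qj by (simp add: complex_eq_iff)
    finally show "1 - x ^ (2 * j + 1) =
        (- \<i>) * of_real (2 * sin (pi * real (2 * j + 1) / real CARD('n))) * inverse (Q ^ (2 * j + 1))"
      by (simp only: \<theta>_def)
  qed simp
  also have "\<dots> = (- \<i>) ^ m * of_real (\<Prod>j<m. 2 * sin (pi * real (2 * j + 1) / real CARD('n))) *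
      inverse (\<Prod>j<m. Q ^ (2 * j + 1))"
    unfolding of_real_prod
    by (simp only: prod.distrib prod_constant card_lessThan prod_inversef [symmetric] o_def)
  \<comment> \<open>The first \<open>m\<close> odd numbers add up to the square of \<open>m\<close>.
    The square of \<open>m + 1\<close> exceeds it by N, so this product cancels the factor pulled
    out when completing the square.\<close>
  also have "(\<Prod>j<m. Q ^ (2 * j + 1)) = Q ^ (m\<^sup>2)"
    by (induction m) (simp_all add: power2_eq_square mult_2 add_ac flip: power_add power_Suc)
  also have "(m + 1)\<^sup>2 = CARD('n) + m\<^sup>2"
    by (simp add: m power2_eq_square)
  finally show ?thesis
    by (simp add: power_add QN)
qed

text \<open>All angles lie between 0 and \<open>pi\<close>, so the sine product is nonnegative and
  must equal the modulus already known; it is never evaluated directly.\<close>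

theorem gauss_sum_eq: "gauss_sum = of_real (sqrt (real CARD('n))) * ipow ((1 - real CARD('n)) / 2)"
proof -
  obtain m where m: "CARD('n) = 2 * m + 1"
    using odd_card by (elim oddE)
  define R where "R = (\<Prod>j<m. 2 * sin (pi * real (2 * j + 1) / real CARD('n)))"
  have "R \<ge> 0"
    unfolding R_def
  proof (rule prod_nonneg)
    fix j assume "j \<in> {..<m}"
    then have "real (2 * j + 1) / real CARD('n) \<le> 1" using m by (simp add: field_simps)
    then have "pi * (real (2 * j + 1) / real CARD('n)) \<le> pi"
      by (metis mult.right_neutral mult_left_mono pi_ge_zero)
    then show "0 \<le> 2 * sin (pi * real (2 * j + 1) / real CARD('n))"
      by (auto intro!: sin_ge_zero)
  qed
  moreover have G: "gauss_sum = (- \<i>) ^ m * of_real R"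
    unfolding R_def by (rule gauss_sum_eq_prod [OF m])
  ultimately have "R = sqrt (real CARD('n))"
    using norm_gauss_sum by (simp add: norm_mult norm_power)
  moreover have "ipow ((1 - real CARD('n)) / 2) = (- \<i>) ^ m"
  proof -
    have "ipow ((1 - real CARD('n)) / 2) = cis (real m * (- (pi / 2)))"
      by (simp add: ipow_def m cis_conv_exp mult_ac)
    also have "\<dots> = cis (- (pi / 2)) ^ m"
      by (simp only: Complex.DeMoivre)
    also have "cis (- (pi / 2)) = - \<i>"
      by (simp add: complex_eq_iff)
    finally show ?thesis .
  qed
  ultimately show ?thesis
    using G by simp
qed

end

section \<open>Functional calculus in dual bases\<close>

text \<open>The pairing is bilinear and normalised to \<open>c\<close>, as for the given bras and
  kets. Completeness is stated next to it and replaces a dimension count between the index types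
  \<open>'t\<close> and \<open>'i\<close>.\<close>

locale dual_bases =
  fixes e b :: "'t::finite \<Rightarrow> complex^'i" and c :: complex
  assumes c_nonzero: "c \<noteq> 0"
    and pairing: "\<And>s t. (\<Sum>i\<in>UNIV. b t $ i * e s $ i) = (if s = t then c else 0)"
    and complete: "\<And>i j. (\<Sum>t\<in>UNIV. e t $ i * b t $ j) = (if i = j then c else 0)"
begin

definition coef :: "'t \<Rightarrow> complex^'i \<Rightarrow> complex" where
  "coef t x = (\<Sum>i\<in>UNIV. b t $ i * x $ i)"

text \<open>Dividing by \<open>c\<close> makes \<open>comb\<close> inverse to \<open>coef\<close>,
  which stays unnormalised so that it is literally a matrix element with a bra.\<close>

definition comb :: "('t \<Rightarrow> complex) \<Rightarrow> complex^'i" where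
  "comb a = (\<Sum>t\<in>UNIV. (a t / c) *s e t)"

lemma comb_nth: "comb a $ i = (\<Sum>t\<in>UNIV. a t * e t $ i) / c"
  by (simp add: comb_def sum_divide_distrib)

lemma comb_scale: "comb (\<lambda>t. z * a t) = z *s comb a"
  by (simp add: vec_eq_iff comb_nth sum_distrib_left mult.assoc)

lemma comb_coef: "comb (\<lambda>t. coef t x) = x"
proof -
  have "(\<Sum>t\<in>UNIV. coef t x * e t $ i) = c * x $ i" for i
  proof -
    have "(\<Sum>t\<in>UNIV. coef t x * e t $ i) = (\<Sum>t\<in>UNIV. \<Sum>j\<in>UNIV. x $ j * (e t $ i * b t $ j))"
      by (simp add: coef_def sum_distrib_left sum_distrib_right mult_ac)
    also have "\<dots> = (\<Sum>j\<in>UNIV. x $ j * (\<Sum>t\<in>UNIV. e t $ i * b t $ j))"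
      by (subst sum.swap) (simp add: sum_distrib_left)
    also have "\<dots> = c * x $ i"
      by (simp add: complete if_distrib [of "\<lambda>z. _ * z"] cong: if_cong)
    finally show ?thesis .
  qed
  then show ?thesis
    using c_nonzero by (simp add: vec_eq_iff comb_nth)
qed

lemma coef_comb: "coef t (comb a) = a t"
proof -
  have "coef t (comb a) = (\<Sum>i\<in>UNIV. \<Sum>s\<in>UNIV. a s / c * (b t $ i * e s $ i))"
    by (simp add: coef_def comb_nth sum_distrib_left sum_divide_distrib mult_ac)
  also have "\<dots> = (\<Sum>s\<in>UNIV. a s / c * (\<Sum>i\<in>UNIV. b t $ i * e s $ i))"
    by (subst sum.swap) (simp add: sum_distrib_left)
  also have "\<dots> = a t"
    using c_nonzero by (simp add: pairing if_distrib [of "\<lambda>z. _ * z"] cong: if_cong)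
  finally show ?thesis .
qed

lemma mult_vec_comb:
  assumes "\<And>t. A *v e t = l t *s e t"
  shows "A *v comb a = comb (\<lambda>t. l t * a t)"
proof -
  have "A *v (\<Sum>t\<in>S. (a t / c) *s e t) = (\<Sum>t\<in>S. A *v ((a t / c) *s e t))" for S :: "'t set"
    by (induction S rule: infinite_finite_induct) (simp_all add: matrix_vector_right_distrib)
  then show ?thesis
    by (simp add: comb_def assms vector_scalar_commute mult.commute)
qed

text \<open>\<open>root_fun\<close> is a definite description, so existence and uniqueness are both
  due. The operator diagonal in the basis \<open>e\<close> is a witness, and spanning by
  \<open>e\<close> leaves no other.\<close>

lemma root_fun_comb:
  assumes "\<And>t. X *v e t = l t *s e t" "\<And>t. \<exists>k. l t = q N powi (2 * k)"
  shows "root_fun N f X *v comb a = comb (\<lambda>t. f (l t) * a t)"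
proof -
  define is_calc where "is_calc M \<longleftrightarrow> (\<forall>k::int. \<forall>x.
     X *v x = (q N powi (2 * k)) *s x \<longrightarrow> M *v x = f (q N powi (2 * k)) *s x)" for M
  have act: "M *v comb a = comb (\<lambda>t. f (l t) * a t)" if "is_calc M" for M a
  proof (rule mult_vec_comb)
    fix t
    show "M *v e t = f (l t) *s e t"
      using that assms(1) [of t] assms(2) [of t] unfolding is_calc_def by metis
  qed
  define M where "M = matrix (\<lambda>x. comb (\<lambda>t. f (l t) * coef t x))"
  have "Vector_Spaces.linear (*s) (*s) (\<lambda>x. comb (\<lambda>t. f (l t) * coef t x))"
    by unfold_locales (simp_all add: vec_eq_iff comb_nth coef_def algebra_simps sum.distrib sum_distrib_left
      add_divide_distrib sum_divide_distrib)
  then have M: "M *v x = comb (\<lambda>t. f (l t) * coef t x)" for x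
    unfolding M_def by (simp add: matrix_works)
  have "is_calc M"
    unfolding is_calc_def
  proof (intro allI impI)
    fix k x assume X: "X *v x = (q N powi (2 * k)) *s x"
    have "l t * coef t x = q N powi (2 * k) * coef t x" for t
    proof -
      have "l t * coef t x = coef t (X *v comb (\<lambda>t. coef t x))"
        unfolding mult_vec_comb [OF assms(1)] coef_comb ..
      also have "\<dots> = q N powi (2 * k) * coef t x"
        unfolding comb_coef X by (simp add: coef_def sum_distrib_left mult_ac)
      finally show ?thesis .
    qed
    \<comment> \<open>Either the coordinate is zero or the two eigenvalues agree; \<open>f\<close>
      may be applied in both cases.\<close>
    then have "f (l t) * coef t x = f (q N powi (2 * k)) * coef t x" for t
      by (metis mult_cancel_right)
    then have "M *v x = comb (\<lambda>t. f (q N powi (2 * k)) * coef t x)"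
      by (simp only: M)
    then show "M *v x = f (q N powi (2 * k)) *s x"
      by (simp only: comb_scale comb_coef)
  qed
  moreover have "M' = M" if "is_calc M'" for M'
    unfolding matrix_eq
    using act [OF that] M by (metis comb_coef)
  ultimately have "is_calc (root_fun N f X)"
    unfolding root_fun_def is_calc_def [symmetric] by (rule theI)
  then show ?thesis
    by (rule act)
qed

text \<open>The dual form: each bra is a left eigenvector of \<open>f(X)\<close>, so the function
  comes out as a scalar in front of an arbitrary vector.\<close>

lemma coef_root_fun:
  assumes "\<And>t. X *v e t = l t *s e t" "\<And>t. \<exists>k. l t = q N powi (2 * k)"
  shows "coef t (root_fun N f X *v x) = f (l t) * coef t x"
  using root_fun_comb [OF assms, of f "\<lambda>t. coef t x"] by (simp add: comb_coef coef_comb)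

text \<open>Summing over \<open>t\<close> first and inserting completeness leaves \<open>c\<close>
  times the diagonal entries. The trace thus follows from the matrix elements.\<close>

lemma trace_eq_sum_coef: "trace M = (\<Sum>t\<in>UNIV. coef t (M *v e t)) / c"
proof -
  have "(\<Sum>t\<in>UNIV. coef t (M *v e t)) =
      (\<Sum>t\<in>UNIV. \<Sum>i\<in>UNIV. \<Sum>j\<in>UNIV. M $ i $ j * (e t $ j * b t $ i))"
    by (simp add: coef_def matrix_vector_mult_def sum_distrib_left mult_ac)
  also have "\<dots> = (\<Sum>i\<in>UNIV. \<Sum>t\<in>UNIV. \<Sum>j\<in>UNIV. M $ i $ j * (e t $ j * b t $ i))"
    by (rule sum.swap)
  also have "\<dots> = (\<Sum>i\<in>UNIV. \<Sum>j\<in>UNIV. M $ i $ j * (\<Sum>t\<in>UNIV. e t $ j * b t $ i))"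
    by (intro sum.cong refl, subst sum.swap) (simp add: sum_distrib_left)
  also have "\<dots> = c * trace M"
    by (simp add: complete trace_def if_distrib [of "\<lambda>z. _ * z"] mult.commute [of c]
        cong: if_cong flip: sum_distrib_right)
  finally show ?thesis
    using c_nonzero by simp
qed

end

section \<open>Monomial matrices\<close>

lemma matrix_inv_eqI:
  fixes A :: "complex^'i^'i"
  assumes "A ** B = mat 1" "B ** A = mat 1"
  shows "matrix_inv A = B"
proof -
  have "A ** matrix_inv A = mat 1 \<and> matrix_inv A ** A = mat 1"
    unfolding matrix_inv_def by (rule someI [of _ B]) (simp add: assms)
  then show ?thesis
    using assms by (metis matrix_mul_assoc matrix_mul_lid matrix_mul_rid)
qed

text \<open>\<open>U_op\<close>, \<open>P_op\<close>, their embeddings and \<open>swap_vw\<close>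
  all have this form, so products reduce to composing index maps and multiplying weights.\<close>

definition monomial_mat :: "('j \<Rightarrow> 'i) \<Rightarrow> ('j \<Rightarrow> complex) \<Rightarrow> complex^'j::finite^'i::finite" where
  "monomial_mat f c = (\<chi> i j. if i = f j then c j else 0)"

lemma monomial_mat_nth: "monomial_mat f c $ i $ j = (if i = f j then c j else 0)"
  by (simp add: monomial_mat_def)

lemma monomial_mat_mult:
  "monomial_mat f c ** monomial_mat g d = monomial_mat (\<lambda>j. f (g j)) (\<lambda>j. c (g j) * d j)"
proof -
  have "(\<Sum>k\<in>UNIV. monomial_mat f c $ i $ k * monomial_mat g d $ k $ j) =
      (\<Sum>k\<in>UNIV. if k = g j then monomial_mat f c $ i $ g j * d j else 0)" for i j
    by (rule sum.cong) (auto simp: monomial_mat_nth)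
  then show ?thesis
    by (simp add: vec_eq_iff matrix_matrix_mult_def monomial_mat_nth)
qed

lemma scale_monomial_mat: "z *\<^sub>m monomial_mat f c = monomial_mat f (\<lambda>j. z * c j)"
  by (simp add: vec_eq_iff monomial_mat_nth)

lemma mat_1_eq_monomial: "mat 1 = monomial_mat (\<lambda>j. j) (\<lambda>j. 1)"
  by (simp add: vec_eq_iff monomial_mat_nth mat_def)

lemma monomial_mat_mult_vec:
  assumes "f (g i) = i" "\<And>j. f j = i \<Longrightarrow> j = g i"
  shows "(monomial_mat f c *v x) $ i = c (g i) * x $ g i"
proof -
  have "i = f j \<longleftrightarrow> j = g i" for j
    using assms by metis
  then have "(monomial_mat f c *v x) $ i = (\<Sum>j\<in>UNIV. if j = g i then c j * x $ j else 0)"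
    by (simp add: matrix_vector_mult_def monomial_mat_nth if_distrib [of "\<lambda>z. z * _"] cong: if_cong)
  then show ?thesis by simp
qed

lemma monomial_mat_eq_0_iff: "monomial_mat f c = 0 \<longleftrightarrow> (\<forall>j. c j = 0)"
  by (auto simp: vec_eq_iff monomial_mat_nth)

lemma tensor_op_monomial:
  "tensor_op (monomial_mat f c) (monomial_mat g d) = monomial_mat (map_prod f g) (\<lambda>j. c (fst j) * d (snd j))"
  by (auto simp: vec_eq_iff tensor_op_def monomial_mat_nth prod_eq_iff)

lemma mat_pow_monomial:
  "mat_pow (monomial_mat f c) k = monomial_mat (f ^^ k) (\<lambda>j. \<Prod>i<k. c ((f ^^ i) j))"
proof (induction k)
  case 0
  then show ?case by (simp add: mat_pow_def mat_1_eq_monomial)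
next
  case (Suc k)
  have "mat_pow (monomial_mat f c) (Suc k) = monomial_mat f c ** mat_pow (monomial_mat f c) k"
    by (simp add: mat_pow_def)
  then show ?case
    by (simp add: Suc monomial_mat_mult mult.commute)
qed

section \<open>Weyl ordering\<close>

text \<open>For \<open>N = 2 * m + 1\<close> the number \<open>m + 1\<close> inverts 2 modulo N, so
  raising to this power undoes the doubling.\<close>

lemma q_powi_double_cancel:
  assumes "odd N" "q N powi (2 * a) = q N powi (2 * b)"
  shows "q N powi a = q N powi b"
proof -
  obtain m where m: "N = 2 * m + 1" using assms(1) by (elim oddE)
  have "q N powi x = (q N powi (2 * x)) powi (int m + 1)" for x
  proof -
    have "(q N powi (2 * x)) powi (int m + 1) = q N powi (x + int N * x)"
      by (simp add: m algebra_simps flip: power_int_mult)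
    also have "\<dots> = q N powi x"
      using assms(1) by (rule q_powi_cong) (simp add: cong_def)
    finally show ?thesis ..
  qed
  then show ?thesis
    using assms(2) by metis
qed

lemma powi_sum: "x \<noteq> 0 \<Longrightarrow> x powi (\<Sum>i\<in>A. f i) = (\<Prod>i\<in>A. x powi f i)" for x :: complex
  by (induction A rule: infinite_finite_induct) (auto simp: power_int_add)

text \<open>\<open>weyl\<close> chooses its exponents by \<open>SOME\<close>. Nonzero products
  determine \<open>q N powi (2 * \<epsilon> i j)\<close>, hence by cancelling the 2 also the
  prefactor, so any valid exponents may be used.\<close>

lemma weyl_eq:
  assumes "odd N" "is_weyl_exponent N Xs \<delta>"
    and nz: "\<And>i j. i < j \<Longrightarrow> j < length Xs \<Longrightarrow> Xs ! j ** Xs ! i \<noteq> 0"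
  shows "weyl N Xs = (q N powi (- (\<Sum>j<length Xs. \<Sum>i<j. \<delta> i j))) *\<^sub>m foldr (**) Xs (mat 1)"
proof -
  define \<epsilon> where "\<epsilon> = (SOME \<epsilon>. is_weyl_exponent N Xs \<epsilon>)"
  have \<epsilon>: "is_weyl_exponent N Xs \<epsilon>"
    unfolding \<epsilon>_def using assms(2) by (rule someI [where P = "is_weyl_exponent N Xs"])
  have "q N powi \<epsilon> i j = q N powi \<delta> i j" if "i < j" "j < length Xs" for i j
  proof (rule q_powi_double_cancel [OF assms(1)])
    have "(q N powi (2 * \<epsilon> i j)) *\<^sub>m (Xs ! j ** Xs ! i) = (q N powi (2 * \<delta> i j)) *\<^sub>m (Xs ! j ** Xs ! i)"
      using \<epsilon> [unfolded is_weyl_exponent_def, rule_format, of i j]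
        assms(2) [unfolded is_weyl_exponent_def, rule_format, of i j] that by simp
    then show "q N powi (2 * \<epsilon> i j) = q N powi (2 * \<delta> i j)"
      using nz [OF that] by (auto simp: vec_eq_iff)
  qed
  then have "q N powi (\<Sum>j<length Xs. \<Sum>i<j. \<epsilon> i j) = q N powi (\<Sum>j<length Xs. \<Sum>i<j. \<delta> i j)"
    by (simp add: powi_sum)
  then show ?thesis
    unfolding weyl_def Let_def \<epsilon>_def [symmetric] by (simp add: power_int_minus)
qed

section \<open>Operators and eigenvectors\<close>

lemma U_op_eq: "U_op = monomial_mat (\<lambda>k. k) q2"
  by (simp add: vec_eq_iff U_op_def ket_def monomial_mat_nth axis_def)

lemma P_op_eq: "P_op = monomial_mat (\<lambda>k. k + of_int_mod_ring 1) (\<lambda>k. 1)"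
  by (simp add: vec_eq_iff P_op_def ket_def monomial_mat_nth axis_def)

lemma at_v_monomial:
  "at_v (monomial_mat f c) = monomial_mat (\<lambda>k. (f (fst k), snd k)) (\<lambda>k. c (fst k))"
  by (simp add: at_v_def mat_1_eq_monomial tensor_op_monomial map_prod_def case_prod_unfold)

lemma at_w_monomial:
  "at_w (monomial_mat f c) = monomial_mat (\<lambda>k. (fst k, f (snd k))) (\<lambda>k. c (snd k))"
  by (simp add: at_w_def mat_1_eq_monomial tensor_op_monomial map_prod_def case_prod_unfold)

lemma swap_vw_eq: "swap_vw = monomial_mat (\<lambda>k. (snd k, fst k)) (\<lambda>k. 1)"
  by (auto simp: vec_eq_iff swap_vw_def tensor_def ket_def axis_def monomial_mat_nth prod_eq_iff)

lemma swap_vw_mult_vec: "(swap_vw *v x) $ i = x $ (snd i, fst i)"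
  unfolding swap_vw_eq
  by (subst monomial_mat_mult_vec [where g = "\<lambda>k. (snd k, fst k)"]) auto

lemma sum_pair: "(\<Sum>i\<in>UNIV. f i) = (\<Sum>a\<in>UNIV. \<Sum>b\<in>UNIV. f (a, b))"
  by (simp add: sum.cartesian_product flip: UNIV_Times_UNIV)

lemma sum_tensor:
  "(\<Sum>i\<in>UNIV. (x \<otimes>\<^sub>v y) $ i * (x' \<otimes>\<^sub>v y') $ i) = (\<Sum>a\<in>UNIV. x $ a * x' $ a) * (\<Sum>b\<in>UNIV. y $ b * y' $ b)"
  by (simp add: sum_pair tensor_def sum_product mult_ac)

lemma ket_P_nth: "ket_P l $ k = inverse (q2 (k * l))"
  by (simp add: ket_P_def ket_def axis_def if_distrib [of "\<lambda>z. _ * z"] cong: if_cong)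

lemma bra_P_nth: "bra_P l $ k = q2 (k * l)"
  by (simp add: bra_P_def bra_def axis_def if_distrib [of "\<lambda>z. _ * z"] cong: if_cong)

lemma ket_PU_nth: "ket_PU k $ m = inverse (gam m) * inverse (q2 (k * m))"
  by (simp add: ket_PU_def ket_def axis_def if_distrib [of "\<lambda>z. _ * z"] cong: if_cong)

lemma bra_PU_nth: "bra_PU l $ m = gam m * q2 (m * l)"
  by (simp add: bra_PU_def bra_def axis_def if_distrib [of "\<lambda>z. _ * z"] cong: if_cong)

section \<open>Dual bases of the two-triangle space\<close>

context odd_order
begin

lemma bra_ket_P: "(\<Sum>k\<in>UNIV. bra_P m $ k * ket_P l $ k) = (if l = m then of_nat CARD('n) else 0)"
  for l m :: "'n mod_ring"
proof -
  have "bra_P m $ k * ket_P l $ k = q2 (k * (m - l))" for k :: "'n mod_ring"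
    by (simp add: bra_P_nth ket_P_nth right_diff_distrib q2_diff)
  then show ?thesis by (auto simp: sum_q2)
qed

lemma ket_bra_P: "(\<Sum>l\<in>UNIV. ket_P l $ i * bra_P l $ j) = (if i = j then of_nat CARD('n) else 0)"
  for i j :: "'n mod_ring"
proof -
  have "ket_P l $ i * bra_P l $ j = q2 (l * (j - i))" for l :: "'n mod_ring"
    by (simp add: bra_P_nth ket_P_nth right_diff_distrib q2_diff mult.commute)
  then show ?thesis by (auto simp: sum_q2)
qed

lemma bra_ket_PU: "(\<Sum>k\<in>UNIV. bra_PU m $ k * ket_PU l $ k) = (if l = m then of_nat CARD('n) else 0)"
  for l m :: "'n mod_ring"
proof -
  have "bra_PU m $ k * ket_PU l $ k = q2 (k * (m - l))" for k :: "'n mod_ring"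
    by (simp add: bra_PU_nth ket_PU_nth right_diff_distrib q2_diff mult.commute)
  then show ?thesis by (auto simp: sum_q2)
qed

lemma ket_bra_PU: "(\<Sum>l\<in>UNIV. ket_PU l $ i * bra_PU l $ j) = (if i = j then of_nat CARD('n) else 0)"
  for i j :: "'n mod_ring"
proof -
  have "ket_PU l $ i * bra_PU l $ j = inverse (gam i) * gam j * q2 (l * (j - i))" for l :: "'n mod_ring"
    by (simp add: bra_PU_nth ket_PU_nth right_diff_distrib q2_diff mult_ac)
  then show ?thesis by (simp add: sum_q2 flip: sum_distrib_left)
qed

text \<open>The mixed choice of bases is dictated by the dilogarithm: its argument is the inverse of
  \<open>[P U^-1]\<close> on the first factor times \<open>P\<close> on the second, and these are
  diagonal here.\<close>

definition ket2 :: "'n mod_ring \<times> 'n mod_ring \<Rightarrow> 'n state2" where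
  "ket2 t = ket_PU (fst t) \<otimes>\<^sub>v ket_P (snd t)"

definition bra2 :: "'n mod_ring \<times> 'n mod_ring \<Rightarrow> 'n state2" where
  "bra2 t = bra_PU (fst t) \<otimes>\<^sub>v bra_P (snd t)"

sublocale dual_bases ket2 bra2 "(of_nat CARD('n))\<^sup>2"
proof
  show "(\<Sum>i\<in>UNIV. bra2 t $ i * ket2 s $ i) = (if s = t then (of_nat CARD('n))\<^sup>2 else 0)" for s t
    by (auto simp: bra2_def ket2_def sum_tensor bra_ket_P bra_ket_PU prod_eq_iff power2_eq_square)
  show "(\<Sum>t\<in>UNIV. ket2 t $ i * bra2 t $ j) = (if i = j then (of_nat CARD('n))\<^sup>2 else 0)" for i j
  proof -
    have "(\<Sum>t\<in>UNIV. ket2 t $ i * bra2 t $ j) =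
        (\<Sum>k\<in>UNIV. ket_PU k $ fst i * bra_PU k $ fst j) * (\<Sum>l\<in>UNIV. ket_P l $ snd i * bra_P l $ snd j)"
      unfolding sum_pair sum_product by (simp add: ket2_def bra2_def tensor_def mult_ac)
    then show ?thesis
      by (simp add: ket_bra_P ket_bra_PU prod_eq_iff power2_eq_square)
  qed
qed simp

lemma matrix_element_bra2: "matrix_element (bra2 t) M x = coef t (M *v x)"
  by (simp add: matrix_element_def coef_def)

abbreviation one_n :: "'n mod_ring" where "one_n \<equiv> of_int_mod_ring 1"

lemma q2_one: "q2 one_n = (q CARD('n))\<^sup>2"
  and gam_one: "gam one_n = q CARD('n)"
  by (simp_all add: q2_of_int gam_of_int)

lemma inverse_P_v: "matrix_inv (at_v P_op) =
    monomial_mat (\<lambda>k :: 'n mod_ring \<times> 'n mod_ring. (fst k - one_n, snd k)) (\<lambda>k. 1)"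
  (is "_ = ?B")
proof (rule matrix_inv_eqI)
  show "at_v P_op ** ?B = mat 1" "?B ** at_v P_op = mat 1"
    by (simp_all add: P_op_eq at_v_monomial monomial_mat_mult mat_1_eq_monomial)
qed

section \<open>The argument of the dilogarithm and its eigenvectors\<close>

definition dilog_arg :: "'n operator2" where
  "dilog_arg = weyl CARD('n) [matrix_inv (at_v P_op), at_v U_op, at_w P_op]"

lemma dilog_arg_eq: "dilog_arg =
    monomial_mat (\<lambda>k. (fst k - one_n, snd k + one_n)) (\<lambda>k. inverse (q CARD('n)) * q2 (fst k))"
proof -
  \<comment> \<open>On the v factor \<open>P^-1 U = q^2 U P^-1\<close>; the third operator acts on
    the other factor and commutes with both.\<close>
  define \<delta> :: "nat \<Rightarrow> nat \<Rightarrow> int" where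
    "\<delta> i j = (if (i, j) = (0, 1) then 1 else if (i, j) = (1, 0) then -1 else 0)" for i j
  define Xs :: "'n operator2 list" where
    "Xs = [matrix_inv (at_v P_op), at_v U_op, at_w P_op]"
  have Xs: "Xs = [monomial_mat (\<lambda>k. (fst k - one_n, snd k)) (\<lambda>k. 1),
      monomial_mat (\<lambda>k. (fst k, snd k)) (\<lambda>k. q2 (fst k)),
      monomial_mat (\<lambda>k. (fst k, snd k + one_n)) (\<lambda>k. 1)]"
    unfolding Xs_def inverse_P_v by (simp add: P_op_eq U_op_eq at_v_monomial at_w_monomial)
  have "is_weyl_exponent CARD('n) Xs \<delta>"
    unfolding is_weyl_exponent_def
    by (simp add: Xs \<delta>_def monomial_mat_mult scale_monomial_mat All_less_Suc2 q2_diff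
      q2_one power_int_minus add_ac)
      (simp add: field_simps)
  moreover have "Xs ! j ** Xs ! i \<noteq> 0" if "i < j" "j < length Xs" for i j
  proof -
    have "i \<in> {0, 1, 2}" "j \<in> {0, 1, 2}" using that by (auto simp: Xs)
    then show ?thesis
      by (auto simp: Xs monomial_mat_mult monomial_mat_eq_0_iff)
  qed
  ultimately have "dilog_arg = (q CARD('n) powi (- (\<Sum>j<length Xs. \<Sum>i<j. \<delta> i j))) *\<^sub>m foldr (**) Xs (mat 1)"
    unfolding dilog_arg_def Xs_def [symmetric] by (intro weyl_eq odd_card)
  also have "(\<Sum>j<length Xs. \<Sum>i<j. \<delta> i j) = 1"
    by (simp add: Xs \<delta>_def)
  finally show ?thesis
    by (simp add: Xs monomial_mat_mult scale_monomial_mat mat_1_eq_monomial power_int_minus)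
qed

text \<open>Shifting the Gaussian of \<open>ket_PU\<close> yields the inverse of
  \<open>q * q2 (fst i)\<close>, which the weight of \<open>dilog_arg\<close> cancels; the shifted
  characters give the eigenvalue.\<close>

lemma dilog_arg_ket2: "dilog_arg *v ket2 t = q2 (snd t - fst t) *s ket2 t"
proof -
  have "(dilog_arg *v ket2 t) $ i = q2 (snd t - fst t) * ket2 t $ i" for i
  proof -
    have "(dilog_arg *v ket2 t) $ i =
        inverse (q CARD('n)) * q2 (fst i + one_n) * ket2 t $ (fst i + one_n, snd i - one_n)"
      unfolding dilog_arg_eq
      by (subst monomial_mat_mult_vec [where g = "\<lambda>k. (fst k + one_n, snd k - one_n)"])
        (auto simp: prod_eq_iff diff_eq_eq eq_diff_eq)
    also have "\<dots> = q2 (snd t - fst t) * ket2 t $ i"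
      by (simp add: ket2_def tensor_def ket_PU_nth ket_P_nth gam_add gam_one q2_add q2_diff q2_one
        distrib_left left_diff_distrib of_int_mod_ring_1_mult mult.commute [of _ one_n] power2_eq_square)
        (simp add: field_simps)
    finally show ?thesis .
  qed
  then show ?thesis by (simp add: vec_eq_iff)
qed

lemma coef_root_fun_dilog_arg:
  "coef t (root_fun CARD('n) f dilog_arg *v x) = f (q2 (snd t - fst t)) * coef t x"
  by (rule coef_root_fun [OF dilog_arg_ket2]) (auto simp: q2_def)

section \<open>The permutation factor of \<open>T_vw\<close>\<close>

lemma q2_power: "q2 b ^ i = q2 (of_int_mod_ring (int i) * b :: 'n mod_ring)"
proof (induction i)
  case (Suc i)
  have "of_int_mod_ring (int (Suc i)) * b = b + of_int_mod_ring (int i) * b"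
    by (simp add: of_int_mod_ring_add distrib_right of_int_mod_ring_1_mult)
  then show ?case
    by (simp add: Suc q2_add)
qed simp

lemma funpow_shift: "((\<lambda>k. (fst k + one_n, snd k)) ^^ j) k = (fst k + of_int_mod_ring (int j), snd k)"
  by (induction j) (simp_all add: of_int_mod_ring_add add_ac)

lemma funpow_ident: "(\<lambda>k. k) ^^ j = (\<lambda>k. k)"
  by (induction j) (auto simp: fun_eq_iff)

text \<open>The summand is a shift by \<open>j\<close> with weight
  \<open>q2 (i * (j + snd k))\<close>. Averaging over \<open>i\<close> retains only
  \<open>j = - snd k\<close>.\<close>

lemma T_vw_eq: "(T_vw f :: 'n operator2) =
    root_fun CARD('n) f dilog_arg ** monomial_mat (\<lambda>k. (fst k - snd k, snd k)) (\<lambda>k. 1)"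
proof -
  define E :: "nat \<Rightarrow> nat \<Rightarrow> 'n operator2" where
    "E i j = (q CARD('n) ^ (2 * i * j)) *\<^sub>m (mat_pow (at_w U_op) i ** mat_pow (at_v P_op) j)" for i j
  have E: "E i j = monomial_mat (\<lambda>k. (fst k + of_int_mod_ring (int j), snd k))
      (\<lambda>k. q2 (of_int_mod_ring (int i) * (of_int_mod_ring (int j) + snd k)))" for i j
  proof -
    have "q CARD('n) ^ (2 * i * j) = q2 (of_int_mod_ring (int i) * of_int_mod_ring (int j) :: 'n mod_ring)"
      by (simp add: q2_of_int power_int_def nat_mult_distrib mult.assoc flip: of_int_mod_ring_mult)
    then show ?thesis
      by (simp add: E_def U_op_eq P_op_eq at_v_monomial at_w_monomial mat_pow_monomial monomial_mat_mult
        scale_monomial_mat funpow_shift funpow_ident q2_power q2_add distrib_left)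
  qed
  have "((1 / of_nat CARD('n)) *\<^sub>m (\<Sum>i<CARD('n). \<Sum>j<CARD('n). E i j)) $ r $ k =
      monomial_mat (\<lambda>k. (fst k - snd k, snd k)) (\<lambda>k. 1) $ r $ k" for r k
  proof -
    have "(\<Sum>i<CARD('n). \<Sum>j<CARD('n). E i j) $ r $ k =
        (\<Sum>a\<in>(UNIV :: 'n mod_ring set). \<Sum>b\<in>UNIV. if r = (fst k + b, snd k) then q2 (a * (b + snd k)) else 0)"
      by (simp add: sum_mod_ring E monomial_mat_nth)
    also have "\<dots> = (\<Sum>b\<in>UNIV. if r = (fst k + b, snd k)
        then \<Sum>a\<in>(UNIV :: 'n mod_ring set). q2 (a * (b + snd k)) else 0)"
      by (subst sum.swap) (auto intro!: sum.cong)
    also have "\<dots> = (\<Sum>b\<in>UNIV. if b = - snd k then if r = (fst k + b, snd k) then of_nat CARD('n) else 0 else 0)"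
      by (rule sum.cong) (auto simp: sum_q2 add_eq_0_iff2)
    finally show ?thesis
      by (simp add: monomial_mat_nth)
  qed
  then have "(1 / of_nat CARD('n)) *\<^sub>m (\<Sum>i<CARD('n). \<Sum>j<CARD('n). E i j) =
      monomial_mat (\<lambda>k. (fst k - snd k, snd k)) (\<lambda>k. 1)"
    by (simp only: vec_eq_iff) blast
  then show ?thesis
    by (simp only: T_vw_def dilog_arg_def E_def)
qed

text \<open>The vector \<open>x\<close> is left general: for the inverse twist along b it is a basis
  ket, for the twist along a it is the image of one under the swap and the inverse of
  \<open>A_op\<close>.\<close>

lemma coef_T_vw: "coef (m, n) (T_vw f *v x) = f (q2 (n - m)) *
    (\<Sum>a\<in>UNIV. \<Sum>b\<in>UNIV. gam a * q2 (a * m) * q2 (b * n) * x $ (a + b, b))"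
proof -
  define S :: "'n operator2" where "S = monomial_mat (\<lambda>k. (fst k - snd k, snd k)) (\<lambda>k. 1)"
  have S: "(S *v x) $ (a, b) = x $ (a + b, b)" for a b
    unfolding S_def
    by (subst monomial_mat_mult_vec [where g = "\<lambda>k. (fst k + snd k, snd k)"]) (auto simp: prod_eq_iff)
  have "coef (m, n) (T_vw f *v x) = f (q2 (n - m)) * coef (m, n) (S *v x)"
    unfolding T_vw_eq S_def [symmetric] matrix_vector_mul_assoc [symmetric] coef_root_fun_dilog_arg by simp
  then show ?thesis
    by (simp add: coef_def sum_pair S bra2_def tensor_def bra_PU_nth bra_P_nth mult_ac)
qed

text \<open>Completing the square: multiplication by \<open>gam b\<close> turns each summand into
  \<open>gam (a + b)\<close>.\<close>

lemma sum_gam_q2: "(\<Sum>a\<in>UNIV. gam a * q2 (a * b)) = gauss_sum * inverse (gam b)"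
  for b :: "'n mod_ring"
proof -
  have "gauss_sum = (\<Sum>a\<in>UNIV. gam (a + b))"
    unfolding gauss_sum_def by (rule sum_shift [symmetric])
  also have "\<dots> = (\<Sum>a\<in>UNIV. gam a * q2 (a * b)) * gam b"
    unfolding sum_distrib_right by (intro sum.cong) (simp_all add: gam_add)
  finally show ?thesis by (simp add: field_simps)
qed

section \<open>Matrix elements of the two twists\<close>

definition A_coeff :: complex where
  "A_coeff = (1 / of_real (sqrt (real CARD('n)))) * ipow ((1 - real CARD('n)) / 6)"

lemma A_coeff_nonzero [simp]: "A_coeff \<noteq> 0"
  by (simp add: A_coeff_def ipow_def)

lemma inverse_A_w_mult_vec:
  fixes y :: "'n state"
  shows "matrix_inv (at_w A_op) *v (y \<otimes>\<^sub>v ket_PU k) = inverse A_coeff *s (y \<otimes>\<^sub>v ket k)"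
proof -
  \<comment> \<open>The columns of \<open>A_op\<close> are scaled kets \<open>ket_PU k\<close>, so
    its inverse has the dual bras as rows; the factor N compensates their pairing.\<close>
  define B :: "'n operator" where
    "B = (\<chi> i j. inverse (A_coeff * of_nat CARD('n)) * bra_PU i $ j)"
  have A: "A_op = (\<chi> i k :: 'n mod_ring. A_coeff * ket_PU k $ i)"
    by (simp add: A_op_def A_coeff_def)
  have AB: "A_op ** B = mat 1" "B ** A_op = mat 1"
  proof -
    have "(\<Sum>k\<in>UNIV. A_op $ i $ k * B $ k $ j) =
        inverse (of_nat CARD('n)) * (\<Sum>k\<in>UNIV. ket_PU k $ i * bra_PU k $ j)" for i j
      by (simp add: A B_def sum_distrib_left field_simps)
    then show "A_op ** B = mat 1"
      by (simp add: vec_eq_iff matrix_matrix_mult_def mat_def ket_bra_PU)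
    have "(\<Sum>k\<in>UNIV. B $ i $ k * A_op $ k $ j) =
        inverse (of_nat CARD('n)) * (\<Sum>k\<in>UNIV. bra_PU i $ k * ket_PU j $ k)" for i j
      by (simp add: A B_def sum_distrib_left field_simps)
    then show "B ** A_op = mat 1"
      by (auto simp: vec_eq_iff matrix_matrix_mult_def mat_def bra_ket_PU)
  qed
  have w: "at_w M ** at_w M' = at_w (M ** M')" for M M' :: "'n operator"
  proof -
    have "(\<Sum>k\<in>UNIV. at_w M $ i $ k * at_w M' $ k $ j) = at_w (M ** M') $ i $ j" for i j
    proof -
      have "(\<Sum>k\<in>UNIV. at_w M $ i $ k * at_w M' $ k $ j) =
        (\<Sum>a\<in>UNIV. if a = fst i then if a = fst j then \<Sum>b\<in>UNIV. M $ snd i $ b * M' $ b $ snd j else 0 else 0)"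
        unfolding sum_pair by (rule sum.cong) (auto simp: at_w_def tensor_op_def mat_def)
      then show ?thesis
        by (simp add: at_w_def tensor_op_def mat_def matrix_matrix_mult_def)
    qed
    then show ?thesis by (simp add: vec_eq_iff matrix_matrix_mult_def)
  qed
  have w1: "at_w (mat 1) = (mat 1 :: 'n operator2)"
    by (auto simp: at_w_def tensor_op_def mat_def vec_eq_iff prod_eq_iff)
  have inv: "matrix_inv (at_w A_op) = at_w B"
    by (rule matrix_inv_eqI) (simp_all add: w w1 AB)
  have wv: "at_w M *v (y \<otimes>\<^sub>v z) = y \<otimes>\<^sub>v (M *v z)" for M and z :: "'n state"
  proof -
    have "(\<Sum>j\<in>UNIV. at_w M $ i $ j * (y \<otimes>\<^sub>v z) $ j) =
      (\<Sum>a\<in>UNIV. if a = fst i then y $ a * (\<Sum>b\<in>UNIV. M $ snd i $ b * z $ b) else 0)" for i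
      unfolding sum_pair by (rule sum.cong) (auto simp: at_w_def tensor_op_def mat_def tensor_def
          sum_distrib_left mult_ac)
    then show ?thesis
      by (simp add: vec_eq_iff matrix_vector_mult_def tensor_def)
  qed
  have "A_op *v ket k = A_coeff *s ket_PU k"
    by (simp add: vec_eq_iff A ket_def matrix_vector_mult_def axis_def if_distrib [of "\<lambda>z. _ * z"] cong: if_cong)
  then have "ket k = A_coeff *s (B *v ket_PU k)"
    by (metis AB(2) matrix_vector_mul_assoc matrix_vector_mul_lid vector_scalar_commute)
  then have "B *v ket_PU k = inverse A_coeff *s ket k"
    by (simp add: vec_eq_iff)
  then show ?thesis
    unfolding inv wv by (simp add: vec_eq_iff tensor_def)
qed

lemma ipow_add: "ipow (x + y) = ipow x * ipow y"
  by (simp add: ipow_def distrib_left add_divide_distrib exp_add)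

text \<open>The two square roots multiply to N, and the phases combine through 1/2 - 1/6 = 1/3. Here
  the exact phase of the Gauss sum enters.\<close>

lemma gauss_sum_div_A_coeff:
  "gauss_sum * inverse A_coeff = of_nat CARD('n) * ipow ((1 - real CARD('n)) / 3)"
proof -
  define s where "s = complex_of_real (sqrt (real CARD('n)))"
  have s: "s * s = of_nat CARD('n)"
    unfolding s_def by (simp flip: of_real_mult)
  have "ipow ((1 - real CARD('n)) / 2) = ipow ((1 - real CARD('n)) / 3) * ipow ((1 - real CARD('n)) / 6)"
    unfolding ipow_add [symmetric] by (rule arg_cong [of _ _ ipow]) (simp add: field_simps)
  then have "gauss_sum * inverse A_coeff = s * s * ipow ((1 - real CARD('n)) / 3)"
    by (simp add: gauss_sum_eq A_coeff_def s_def [symmetric] ipow_def)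
  then show ?thesis by (simp only: s)
qed

text \<open>After the swap, the inverse of \<open>A_op\<close> turns \<open>ket_PU k\<close> into a
  multiple of \<open>ket k\<close>. The sum over \<open>b\<close> collapses to \<open>b = k\<close>,
  and the sum over \<open>a\<close> is a Gauss sum.\<close>

lemma coef_V_Ta:
  "coef (m, n) (V_Ta \<Psi> p *v ket2 (k, l)) = of_nat CARD('n) * ipow ((1 - real CARD('n)) / 3) *
     \<Psi> (p Edge1) (q2 (n - m)) * inverse (gam (m - l)) * q2 ((n - l) * k)"
proof -
  have "swap_vw *v ket2 (k, l) = ket_P l \<otimes>\<^sub>v ket_PU k"
    by (simp add: vec_eq_iff swap_vw_mult_vec ket2_def tensor_def)
  then have "V_Ta \<Psi> p *v ket2 (k, l) = T_vw (\<Psi> (p Edge1)) *v (inverse A_coeff *s (ket_P l \<otimes>\<^sub>v ket k))"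
    unfolding V_Ta_def matrix_vector_mul_assoc [symmetric] by (simp only: inverse_A_w_mult_vec)
  then have "coef (m, n) (V_Ta \<Psi> p *v ket2 (k, l)) = \<Psi> (p Edge1) (q2 (n - m)) *
      (\<Sum>a\<in>UNIV. \<Sum>b\<in>UNIV. gam a * q2 (a * m) * q2 (b * n) *
        (inverse A_coeff * (inverse (q2 ((a + b) * l)) * (if b = k then 1 else 0))))"
    by (simp add: coef_T_vw tensor_def ket_P_nth ket_def axis_def)
  also have "(\<Sum>a\<in>UNIV. \<Sum>b\<in>UNIV. gam a * q2 (a * m) * q2 (b * n) *
        (inverse A_coeff * (inverse (q2 ((a + b) * l)) * (if b = k then 1 else 0)))) =
      (\<Sum>a\<in>UNIV. gam a * q2 (a * m) * q2 (k * n) * (inverse A_coeff * inverse (q2 ((a + k) * l))))"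
    by (simp add: if_distrib [of "\<lambda>z. _ * z"] cong: if_cong)
  also have "\<dots> = q2 ((n - l) * k) * inverse A_coeff * (\<Sum>a\<in>UNIV. gam a * q2 (a * (m - l)))"
    unfolding sum_distrib_left
    by (simp add: q2_diff q2_add algebra_simps)
  also have "\<dots> = q2 ((n - l) * k) * (gauss_sum * inverse A_coeff) * inverse (gam (m - l))"
    unfolding sum_gam_q2 by simp
  finally show ?thesis
    unfolding gauss_sum_div_A_coeff by simp
qed

text \<open>The Gaussian in \<open>a\<close> from the bra cancels against that of the ket at
  \<open>a + b\<close>. The sum over \<open>a\<close> is then a character sum forcing
  \<open>b = m - k\<close>, with no Gauss sum.\<close>

lemma coef_V_Tb_inv:
  "coef (m, n) (V_Tb_inv \<Psi> p *v ket2 (k, l)) = of_nat CARD('n) * \<Psi> (p Edge1) (q2 (n - m)) *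
     gam (k - m) * q2 ((n - m - l) * (m - k))"
proof -
  have *: "gam a * q2 (a * m) * q2 (b * n) * ket2 (k, l) $ (a + b, b) =
      q2 (b * (n - k - l)) * inverse (gam b) * q2 (a * (m - k - b))" for a b
    by (simp add: ket2_def tensor_def ket_PU_nth ket_P_nth gam_add q2_add q2_diff algebra_simps)
  have "(\<Sum>a\<in>UNIV. \<Sum>b\<in>UNIV. gam a * q2 (a * m) * q2 (b * n) * ket2 (k, l) $ (a + b, b)) =
      (\<Sum>b\<in>UNIV. q2 (b * (n - k - l)) * inverse (gam b) * (\<Sum>a\<in>UNIV. q2 (a * (m - k - b))))"
    unfolding * by (subst sum.swap) (simp add: sum_distrib_left)
  also have "\<dots> = (\<Sum>b\<in>UNIV. if b = m - k then q2 (b * (n - k - l)) * inverse (gam b) * of_nat CARD('n) else 0)"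
    by (rule sum.cong) (auto simp: sum_q2)
  also have "\<dots> = of_nat CARD('n) * (q2 ((m - k) * (n - k - l)) * inverse (gam (m - k)))"
    by simp
  also have "q2 ((m - k) * (n - k - l)) * inverse (gam (m - k)) = gam (k - m) * q2 ((n - m - l) * (m - k))"
  proof -
    define d where "d = m - k"
    \<comment> \<open>Expanding this by \<open>gam_add\<close> expresses \<open>q2 (d * d)\<close>
      through \<open>gam\<close>, which converts the inverse Gaussian into the stated one.\<close>
    have "gam (d + - d) = 1" by simp
    then have "q2 (d * d) = gam d * gam d"
      unfolding gam_add by (simp add: gam_minus q2_minus field_simps)
    moreover have "d * (n - k - l) = (n - m - l) * d + d * d" "k - m = - d"
      by (simp_all add: d_def algebra_simps)
    ultimately show ?thesis
      unfolding d_def [symmetric] by (simp add: q2_add gam_minus)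
  qed
  finally show ?thesis
    unfolding V_Tb_inv_def coef_T_vw by simp
qed

section \<open>The invariants as traces\<close>

lemma sum_difference: "(\<Sum>k\<in>UNIV. \<Sum>l\<in>UNIV. f (l - k)) = of_nat CARD('n) * (\<Sum>u\<in>UNIV. f u)"
  for f :: "'n mod_ring \<Rightarrow> complex"
  using sum_shift [of f "- _"] by simp

lemma ipow_norm: "cmod (ipow x) = 1"
  by (simp add: ipow_def norm_exp)

text \<open>On the diagonal the last character is 1 and \<open>gam\<close> is even, so the entries
  depend on \<open>l - k\<close> alone. The resulting N and the N of each entry cancel the
  normalisation of the bases, and \<open>ipow\<close> has modulus 1.\<close>

lemma Z_inv_V_Ta: "Z_inv (V_Ta \<Psi> p :: 'n operator2) =
    cmod (\<Sum>u\<in>(UNIV :: 'n mod_ring set). \<Psi> (p Edge1) (q2 u) * inverse (gam u))"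
proof -
  have "coef (k, l) (V_Ta \<Psi> p *v ket2 (k, l)) = of_nat CARD('n) * ipow ((1 - real CARD('n)) / 3) *
     (\<Psi> (p Edge1) (q2 (l - k)) * inverse (gam (l - k)))" for k l :: "'n mod_ring"
    using gam_minus [of "k - l"] by (simp add: coef_V_Ta)
  then have "trace (V_Ta \<Psi> p :: 'n operator2) =
     (\<Sum>k\<in>UNIV. \<Sum>l\<in>UNIV. of_nat CARD('n) * ipow ((1 - real CARD('n)) / 3) *
     (\<Psi> (p Edge1) (q2 (l - k :: 'n mod_ring)) * inverse (gam (l - k)))) / (of_nat CARD('n))\<^sup>2"
    by (simp add: trace_eq_sum_coef sum_pair)
  also have "\<dots> = ipow ((1 - real CARD('n)) / 3) *
      (\<Sum>u\<in>(UNIV :: 'n mod_ring set). \<Psi> (p Edge1) (q2 u) * inverse (gam u))"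
    unfolding sum_distrib_left [symmetric] sum_difference [of "\<lambda>u. \<Psi> (p Edge1) (q2 u) * inverse (gam u)"]
    by (simp add: power2_eq_square)
  finally show ?thesis
    by (simp add: Z_inv_def norm_mult ipow_norm)
qed

lemma Z_inv_V_Tb_inv: "Z_inv (V_Tb_inv \<Psi> p :: 'n operator2) =
    cmod (\<Sum>u\<in>(UNIV :: 'n mod_ring set). \<Psi> (p Edge1) (q2 u))"
proof -
  have "trace (V_Tb_inv \<Psi> p :: 'n operator2) = (\<Sum>k\<in>UNIV. \<Sum>l\<in>UNIV. of_nat CARD('n) *
     \<Psi> (p Edge1) (q2 (l - k :: 'n mod_ring))) / (of_nat CARD('n))\<^sup>2"
    by (simp add: trace_eq_sum_coef sum_pair coef_V_Tb_inv)
  also have "\<dots> = (\<Sum>u\<in>(UNIV :: 'n mod_ring set). \<Psi> (p Edge1) (q2 u))"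
    unfolding sum_distrib_left [symmetric] sum_difference [of "\<lambda>u. \<Psi> (p Edge1) (q2 u)"]
    by (simp add: power2_eq_square)
  finally show ?thesis
    by (simp add: Z_inv_def)
qed

end

theorem proposition6p15:
  fixes \<Psi> :: "complex \<times> complex \<Rightarrow> complex \<Rightarrow> complex"
    and pa pb :: "edge \<Rightarrow> complex \<times> complex"
  assumes "odd CARD('n::finite)"
    and "coefficient CARD('n) pa" and "dilog_branch CARD('n) (pa Edge1) (\<Psi> (pa Edge1))"
    and "coefficient CARD('n) pb" and "dilog_branch CARD('n) (pb Edge1) (\<Psi> (pb Edge1))"
  shows
    "(\<forall>k l m n :: 'n mod_ring.
        matrix_element (bra_PU m \<otimes>\<^sub>v bra_P n) (V_Ta \<Psi> pa) (ket_PU k \<otimes>\<^sub>v ket_P l) =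
          of_nat CARD('n) * ipow ((1 - real CARD('n)) / 3) * \<Psi> (pa Edge1) (q2 (n - m)) *
            inverse (gam (m - l)) * q2 ((n - l) * k)) \<and>
     Z_inv (V_Ta \<Psi> pa :: 'n operator2) =
       cmod (\<Sum>u\<in>(UNIV :: 'n mod_ring set). \<Psi> (pa Edge1) (q2 u) * inverse (gam u)) \<and>
     (\<forall>k l m n :: 'n mod_ring.
        matrix_element (bra_PU m \<otimes>\<^sub>v bra_P n) (V_Tb_inv \<Psi> pb) (ket_PU k \<otimes>\<^sub>v ket_P l) =
          of_nat CARD('n) * \<Psi> (pb Edge1) (q2 (n - m)) * gam (k - m) *
            q2 ((n - m - l) * (m - k))) \<and>
     Z_inv (V_Tb_inv \<Psi> pb :: 'n operator2) =
       cmod (\<Sum>u\<in>(UNIV :: 'n mod_ring set). \<Psi> (pb Edge1) (q2 u))"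
proof -
  interpret odd_order "TYPE('n)" by unfold_locales (rule assms(1))
  have ket: "ket_PU k \<otimes>\<^sub>v ket_P l = ket2 (k, l)" and bra: "bra_PU k \<otimes>\<^sub>v bra_P l = bra2 (k, l)"
    for k l :: "'n mod_ring"
    by (simp_all add: ket2_def bra2_def)
  show ?thesis
    unfolding ket bra matrix_element_bra2 coef_V_Ta coef_V_Tb_inv Z_inv_V_Ta Z_inv_V_Tb_inv
    by blast
qed

end
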